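(* Let $k$ be an integer with $k\geq 6$. Let $P^\star$ be the line segment whose vertices are the lattice points $(k,2,1)$ and $(0,k-1,k)$, and let $Q^\star$ be the line segment whose extremities are the origin of $\mathbb{R}^3$ and the lattice point $(k-1,k,k)$. Then, up to the symmetries of the cube $[0,k]^3$, $\varepsilon(3,k)$ is uniquely achieved by the pair $P^\star$ and $Q^\star$.
   Context: A lattice polytope is the convex hull of finitely many points of $\mathbb{Z}^d$. For positive integers $d$ and $k$, a lattice $(d,k)$-polytope is a lattice polytope contained in the hypercube $[0,k]^d$. Distances are Euclidean: $d(P,Q)=\min\{\|p-q\|:p\in P,\ q\in Q\}$. The number $\varepsilon(d,k)$ is the smallest possible value of $d(P,Q)$ over all pairs of disjoint lattice $(d,k)$-polytopes $P$ and $Q$. A pair of disjoint lattice $(d,k)$-polytopes $P$ and $Q$ achieves $\varepsilon(d,k)$ when $d(P,Q)=\varepsilon(d,k)$. The symmetries of the cube $[0,k]^3$ are the isometries of $\mathbb{R}^3$ that map $[0,k]^3$ to itself.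
   Formalization: Uniqueness is stated for inclusion-minimal achieving pairs, and every achieving pair is shown to contain a symmetric image of P*, Q*; over all pairs of polytopes it fails, e.g. the convex hull of P* and (1,0,0), paired with Q*, also achieves ε(3,k). *)

theory Defs
  imports "HOL-Analysis.Analysis"
begin

definition integer_lattice :: "(real^'n) set" where
  "integer_lattice = {x. \<forall>i. x $ i \<in> \<int>}"

(* The empty set is excluded: distances between polytopes are minima over pairs of points,
   whereas the library has setdist {} Q = 0. *)
definition lattice_polytope :: "(real^'n) set \<Rightarrow> bool" where
  "lattice_polytope P \<longleftrightarrow>
     (\<exists>V. finite V \<and> V \<noteq> {} \<and> V \<subseteq> integer_lattice \<and> P = convex hull V)"

definition hypercube :: "nat \<Rightarrow> (real^'n) set" where
  "hypercube k = {x. \<forall>i. 0 \<le> x $ i \<and> x $ i \<le> real k}"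

text \<open>Lattice \<open>(d,k)\<close>-polytopes, where \<open>d = CARD('n)\<close>.\<close>
definition lattice_polytope_in :: "nat \<Rightarrow> (real^'n) set \<Rightarrow> bool" where
  "lattice_polytope_in k P \<longleftrightarrow> lattice_polytope P \<and> P \<subseteq> hypercube k"

definition disjoint_lattice_polytopes :: "nat \<Rightarrow> (real^'n) set \<Rightarrow> (real^'n) set \<Rightarrow> bool" where
  "disjoint_lattice_polytopes k P Q \<longleftrightarrow>
     lattice_polytope_in k P \<and> lattice_polytope_in k Q \<and> P \<inter> Q = {}"

text \<open>\<open>\<epsilon>(d,k)\<close> with \<open>d = CARD('n)\<close>. The infimum is a minimum, since \<open>[0,k]\<^sup>d\<close> contains finitely many
  lattice polytopes; likewise \<open>setdist\<close> is a minimum on nonempty compact sets.\<close>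
definition kissing_distance :: "'n::finite itself \<Rightarrow> nat \<Rightarrow> real" where
  "kissing_distance _ k =
     Inf {setdist P Q | P Q :: (real^'n) set. disjoint_lattice_polytopes k P Q}"

definition achieves_kissing_distance ::
    "nat \<Rightarrow> (real^'n::finite) set \<Rightarrow> (real^'n) set \<Rightarrow> bool" where
  "achieves_kissing_distance k P Q \<longleftrightarrow>
     disjoint_lattice_polytopes k P Q \<and> setdist P Q = kissing_distance TYPE('n) k"

text \<open>Enlarging a polytope of an achieving pair on the side facing away from the other one leaves
  the distance unchanged, so uniqueness is a statement about inclusion-minimal achieving pairs.\<close>
definition minimally_achieves_kissing_distance ::
    "nat \<Rightarrow> (real^'n::finite) set \<Rightarrow> (real^'n) set \<Rightarrow> bool" where
  "minimally_achieves_kissing_distance k P Q \<longleftrightarrow>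
     achieves_kissing_distance k P Q \<and>
     (\<forall>P' Q'. P' \<subseteq> P \<and> Q' \<subseteq> Q \<and> achieves_kissing_distance k P' Q' \<longrightarrow> P' = P \<and> Q' = Q)"

definition cube_symmetries :: "nat \<Rightarrow> (real^'n \<Rightarrow> real^'n) set" where
  "cube_symmetries k =
     {f. (\<forall>x y. dist (f x) (f y) = dist x y) \<and> f ` hypercube k = hypercube k}"

definition P_star :: "nat \<Rightarrow> (real^3) set" where
  "P_star k = closed_segment (vector [real k, 2, 1]) (vector [0, real k - 1, real k])"

definition Q_star :: "nat \<Rightarrow> (real^3) set" where
  "Q_star k = closed_segment 0 (vector [real k - 1, real k, real k])"

end

theory Submission
  imports Defs
begin

text \<open>
  Let \<open>z\<close> be a shortest vector between two disjoint lattice polytopes. By a conic version of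
  Caratheodory's theorem, \<open>z\<close> joins points of affinely independent sets \<open>S\<close> and \<open>T\<close> of vertices
  with \<open>card S + card T \<le> 4\<close>, all of whose edges are orthogonal to \<open>z\<close>. If \<open>S\<close> or \<open>T\<close> is a
  single vertex then \<open>z\<close> is far too long, since a lattice triangle in the cube has a normal vector
  of squared length at most \<open>3k\<^sup>4\<close>. Otherwise \<open>S\<close> and \<open>T\<close> are two edges, with directions \<open>u\<close>
  and \<open>v\<close>, and \<open>\<parallel>z\<parallel>\<close> is a nonzero integer divided by \<open>\<parallel>u \<times> v\<parallel>\<close>. Hence one
  has to maximise \<open>\<parallel>u \<times> v\<parallel>\<close> over the pairs of edges for which that integer is \<open>\<plusminus>1\<close>.

  Up to a symmetry of the cube, \<open>u = (-x1, x2, x3)\<close> and \<open>v = (y1, y2, y3)\<close> with nonnegative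
  coordinates. If both edges span the full side of the cube in some coordinate, then the integer is
  a multiple of \<open>k\<close> (up to a factor \<open>2\<close>). So all defects \<open>ci = 2k - xi - yi\<close> are positive, and
  since \<open>\<parallel>u \<times> v\<parallel>\<^sup>2\<close> is a convex function of each pair \<open>(xi, yi)\<close>, evaluating it at the vertices
  of the polygons cut out by the defects leaves only \<open>c1 = 1\<close> and \<open>c2 + c3 \<le> 4\<close>. In each of these
  finitely many cases the integer is an explicit quadratic polynomial in \<open>k\<close>.
\<close>

unbundle cross3_syntax

subsection \<open>Maximising the cross product of two edges\<close>

text \<open>\<open>\<parallel>u \<times> v\<parallel>\<^sup>2\<close> for \<open>u = (-x1, x2, x3)\<close> and \<open>v = (y1, y2, y3)\<close>.\<close>
definition normal_sq :: "int \<times> int \<Rightarrow> int \<times> int \<Rightarrow> int \<times> int \<Rightarrow> int" where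
  "normal_sq = (\<lambda>(x1, y1) (x2, y2) (x3, y3).
     (x2 * y3 - x3 * y2)\<^sup>2 + (x3 * y1 + x1 * y3)\<^sup>2 + (x1 * y2 + x2 * y1)\<^sup>2)"

text \<open>\<open>\<parallel>u \<times> v\<parallel>\<^sup>2\<close> for the directions \<open>u\<close> of \<open>P_star k\<close> and \<open>v\<close> of \<open>Q_star k\<close>.\<close>
definition extremal_sq :: "int \<Rightarrow> int" where
  "extremal_sq k = 8 * k ^ 4 - 24 * k ^ 3 + 40 * k\<^sup>2 - 28 * k + 10"

section \<open>Convexity on a square with one corner cut off\<close>

text \<open>\<open>x\<close> and \<open>y\<close> are the extents of the two edges in one
  coordinate; the last constraint says that their defect is at least \<open>c\<close>.\<close>

definition cut_square :: "int \<Rightarrow> int \<Rightarrow> (int \<times> int) set" where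
  "cut_square k c = {(x, y). 0 \<le> x \<and> x \<le> k \<and> 0 \<le> y \<and> y \<le> k \<and> x + y \<le> 2 * k - c}"

definition cut_square_vertices :: "int \<Rightarrow> int \<Rightarrow> (int \<times> int) set" where
  "cut_square_vertices k c = {(0, 0), (k, 0), (0, k), (k, k - c), (k - c, k)}"

text \<open>A value of at least \<open>m\<close> at \<open>t\<close> would give the chords from
  \<open>l\<close> to \<open>t\<close> and from \<open>t\<close> to \<open>u\<close> a positive and
  a negative slope, which contradicts \<open>0 \<le> a\<close>.\<close>

lemma convex_quadratic_less:
  fixes a b c l t u m :: int
  assumes "0 \<le> a" "l \<le> t" "t \<le> u"
    and "a * l\<^sup>2 + b * l + c < m" "a * u\<^sup>2 + b * u + c < m"
  shows "a * t\<^sup>2 + b * t + c < m"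
proof (rule ccontr)
  assume "\<not> ?thesis"
  then have "0 < (t - l) * (a * (t + l) + b)" "0 < (u - t) * (- (a * (t + u) + b))"
    using assms(4,5) by (simp_all add: algebra_simps power2_eq_square)
  then have "0 < a * (t + l) + b" "a * (t + u) + b < 0"
    using assms(2,3) by (auto simp: zero_less_mult_iff)
  then have "a * (u - l) < 0" by (simp add: algebra_simps)
  moreover have "0 \<le> a * (u - l)" using assms(1-3) by simp
  ultimately show False by simp
qed

text \<open>Convexity is needed only along the edge directions of the pentagon: \<open>a\<close>,
  \<open>d\<close> and \<open>a - b + d\<close> are the leading coefficients of \<open>f\<close> in
  the directions \<open>(1, 0)\<close>, \<open>(0, 1)\<close> and \<open>(1, -1)\<close>. A vertical
  chord reduces the claim to the boundary, and each boundary edge reduces to its end points. All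
  chords end in integer points.\<close>

lemma quadratic_form_less_on_cut_square:
  fixes k c m :: int
  assumes f: "\<And>x y. f (x, y) = a * x\<^sup>2 + b * x * y + d * y\<^sup>2 + e"
    and "0 \<le> a" "0 \<le> d" "0 \<le> a - b + d" and c: "0 \<le> c" "c \<le> k"
    and p: "p \<in> cut_square k c"
    and vertices: "\<And>v. v \<in> cut_square_vertices k c \<Longrightarrow> f v < m"
  shows "f p < m"
proof -
  obtain x y where xy: "p = (x, y)" by force
  have bounds: "0 \<le> x" "x \<le> k" "0 \<le> y" "y \<le> k" "x + y \<le> 2 * k - c"
    using p xy by (auto simp: cut_square_def)
  have horizontal: "f (t, y) < m" if "l \<le> t" "t \<le> u" "f (l, y) < m" "f (u, y) < m" for l t u y
    using convex_quadratic_less[of a l t u "b * y" "d * y\<^sup>2 + e" m] that assms(2)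
    by (simp add: f algebra_simps)
  have vertical: "f (x, t) < m" if "l \<le> t" "t \<le> u" "f (x, l) < m" "f (x, u) < m" for l t u x
    using convex_quadratic_less[of d l t u "b * x" "a * x\<^sup>2 + e" m] that assms(3)
    by (simp add: f algebra_simps)
  have diagonal: "f (t, s - t) < m"
    if "l \<le> t" "t \<le> u" "f (l, s - l) < m" "f (u, s - u) < m" for l t u s
    using convex_quadratic_less[of "a - b + d" l t u "b * s - 2 * d * s" "d * s\<^sup>2 + e" m] that assms(4)
    by (simp add: f algebra_simps power2_eq_square)
  have v: "f (0, 0) < m" "f (k, 0) < m" "f (0, k) < m" "f (k, k - c) < m" "f (k - c, k) < m"
    using vertices by (auto simp: cut_square_vertices_def)
  have bottom: "f (x, 0) < m" using horizontal[of 0 x k 0] bounds v by auto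
  \<comment> \<open>The upper end of the vertical chord lies on the top edge if
    \<open>x \<le> k - c\<close>, and on the cut edge \<open>x + y = 2 * k - c\<close>
    otherwise.\<close>
  have "\<exists>u \<ge> y. f (x, u) < m"
  proof (cases "x \<le> k - c")
    case True
    then show ?thesis using horizontal[of 0 x "k - c" k] bounds v by auto
  next
    case False
    then show ?thesis
      using diagonal[of "k - c" x k "2 * k - c"] bounds v
      by (intro exI[of _ "2 * k - c - x"]) (auto simp: algebra_simps)
  qed
  then show ?thesis using vertical[of 0 y _ x] bottom bounds xy by auto
qed

lemma normal_sq_swap: "normal_sq p q r = normal_sq p r q"
  by (cases p; cases q; cases r) (simp add: normal_sq_def power2_eq_square algebra_simps)

lemma normal_sq_less_on_cut_square1:
  assumes c: "0 \<le> c" "c \<le> k" and p: "p \<in> cut_square k c"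
    and vertices: "\<And>v. v \<in> cut_square_vertices k c \<Longrightarrow> normal_sq v q r < m"
  shows "normal_sq p q r < m"
proof -
  obtain x2 y2 x3 y3 where [simp]: "q = (x2, y2)" "r = (x3, y3)" by force
  \<comment> \<open>This is \<open>a - b + d\<close> for the coefficients chosen below.\<close>
  have "0 \<le> (x2 - y2)\<^sup>2 + (x3 - y3)\<^sup>2" by simp
  then show ?thesis
    by (intro quadratic_form_less_on_cut_square[where a = "y2\<^sup>2 + y3\<^sup>2" and b = "2 * (x2 * y2 + x3 * y3)"
        and d = "x2\<^sup>2 + x3\<^sup>2" and e = "(x2 * y3 - x3 * y2)\<^sup>2" and f = "\<lambda>p. normal_sq p q r",
        OF _ _ _ _ c p vertices])
      (simp_all add: normal_sq_def power2_eq_square algebra_simps)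
qed

lemma normal_sq_less_on_cut_square2:
  assumes c: "0 \<le> c" "c \<le> k" and q: "q \<in> cut_square k c"
    and vertices: "\<And>v. v \<in> cut_square_vertices k c \<Longrightarrow> normal_sq p v r < m"
  shows "normal_sq p q r < m"
proof -
  obtain x1 y1 x3 y3 where [simp]: "p = (x1, y1)" "r = (x3, y3)" by force
  have "0 \<le> (x1 - y1)\<^sup>2 + (x3 + y3)\<^sup>2" by simp
  then show ?thesis
    by (intro quadratic_form_less_on_cut_square[where a = "y1\<^sup>2 + y3\<^sup>2" and b = "2 * (x1 * y1 - x3 * y3)"
        and d = "x1\<^sup>2 + x3\<^sup>2" and e = "(x3 * y1 + x1 * y3)\<^sup>2" and f = "\<lambda>q. normal_sq p q r",
        OF _ _ _ _ c q vertices])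
      (simp_all add: normal_sq_def power2_eq_square algebra_simps)
qed

lemma normal_sq_less_on_cut_squares:
  assumes "0 \<le> c2" "c2 \<le> k" "0 \<le> c3" "c3 \<le> k" "q \<in> cut_square k c2" "r \<in> cut_square k c3"
    and "\<And>v w. v \<in> cut_square_vertices k c2 \<Longrightarrow> w \<in> cut_square_vertices k c3 \<Longrightarrow> normal_sq p v w < m"
  shows "normal_sq p q r < m"
proof (rule normal_sq_less_on_cut_square2[OF assms(1,2,5)])
  fix v
  assume "v \<in> cut_square_vertices k c2"
  then have "normal_sq p r v < m"
    using assms(7) by (intro normal_sq_less_on_cut_square2[OF assms(3,4,6)]) (simp add: normal_sq_swap[of p _ v])
  then show "normal_sq p v r < m" by (simp add: normal_sq_swap)
qed

text \<open>Excludes a defect of 2 or more in the first coordinate. By convexity in each pair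
  separately, only the 125 triples of vertices have to be compared with
  \<open>extremal_sq k\<close>.\<close>

lemma normal_sq_less_if_sum_le:
  fixes k :: int
  assumes "6 \<le> k" "p1 \<in> cut_square k 2" "p2 \<in> cut_square k 1" "p3 \<in> cut_square k 1"
  shows "normal_sq p1 p2 p3 < extremal_sq k"
proof (rule normal_sq_less_on_cut_square1[OF _ _ assms(2)], goal_cases)
  case (3 v)
  \<comment> \<open>With \<open>k = 6 + j\<close> each vertex inequality becomes linear in the
    monomials \<open>j\<close>, ..., \<open>j ^ 4\<close>, and their nonnegativity is enough to
    prove it.\<close>
  define j where "j = k - 6"
  then have j: "k = 6 + j" and nonneg: "0 \<le> j" "0 \<le> j * j" "0 \<le> j * (j * j)" "0 \<le> j * (j * (j * j))"
    using assms(1) by auto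
  have "\<forall>v1\<in>cut_square_vertices k 2. \<forall>v2\<in>cut_square_vertices k 1.
      \<forall>v3\<in>cut_square_vertices k 1. normal_sq v1 v2 v3 < extremal_sq k"
    unfolding j
    by (simp add: cut_square_vertices_def normal_sq_def extremal_sq_def algebra_simps
        power2_eq_square power3_eq_cube power4_eq_xxxx; intro conjI; insert nonneg; linarith)
  then show ?case
    using assms 3 by (intro normal_sq_less_on_cut_squares[OF _ _ _ _ assms(3,4)]) auto
qed (use assms in auto)

text \<open>The listed pairs are those with positive entries and sum 5. Every pair of positive
  defects with \<open>c2 + c3 \<ge> 5\<close> dominates one of them, so all such pairs are ruled
  out.\<close>

lemma normal_sq_less_if_near_diagonal:
  fixes k :: int
  assumes k: "6 \<le> k" and p: "p2 \<in> cut_square k c2" "p3 \<in> cut_square k c3"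
    and c: "(c2, c3) \<in> {(4, 1), (3, 2), (2, 3), (1, 4)}"
  shows "normal_sq (k, k - 1) p2 p3 < extremal_sq k"
proof -
  define j where "j = k - 6"
  then have j: "k = 6 + j" and nonneg: "0 \<le> j" "0 \<le> j * j" "0 \<le> j * (j * j)" "0 \<le> j * (j * (j * j))"
    using assms(1) by auto
  have *: "normal_sq (k, k - 1) p q < extremal_sq k"
    if pq: "p \<in> cut_square k a" "q \<in> cut_square k b" and "a = 4 \<and> b = 1 \<or> a = 3 \<and> b = 2" for p q a b
  proof -
    have "\<forall>v2 \<in> cut_square_vertices k a. \<forall>v3 \<in> cut_square_vertices k b.
        normal_sq (k, k - 1) v2 v3 < extremal_sq k"
      using that(3) unfolding j
      by (elim disjE conjE; simp add: cut_square_vertices_def normal_sq_def extremal_sq_def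
          algebra_simps power2_eq_square power3_eq_cube power4_eq_xxxx;
          intro conjI; insert nonneg; linarith)
    then show ?thesis
      using that(3) k by (intro normal_sq_less_on_cut_squares[OF _ _ _ _ pq]) auto
  qed
  show ?thesis
    using c *[OF p] *[OF p(2,1)] by (auto simp: normal_sq_swap[of _ p3 p2])
qed

section \<open>Small defects: the determinant as a polynomial in \<open>k\<close>\<close>

text \<open>Each alternative forces the terms in \<open>k\<close> above
  \<open>\<bar>r\<bar> + 2\<close> in absolute value: the leading term minus the next one grows with
  \<open>k\<close>, so its value at 6 decides. The conditions do not mention \<open>k\<close> and
  can be evaluated on numerals.\<close>

lemma quadratic_ne_pm2:
  fixes k t l r :: int
  assumes k: "6 \<le> k"
    and "6 * \<bar>t\<bar> > \<bar>l\<bar> \<and> 6 * (6 * \<bar>t\<bar> - \<bar>l\<bar>) > \<bar>r\<bar> + 2 \<or> t = 0 \<and> 6 * \<bar>l\<bar> > \<bar>r\<bar> + 2"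
  shows "t * k\<^sup>2 + l * k + r \<notin> {2, -2}"
proof -
  have "\<bar>r\<bar> + 2 < \<bar>t * k\<^sup>2 + l * k\<bar>"
    using assms(2)
  proof
    assume *: "6 * \<bar>t\<bar> > \<bar>l\<bar> \<and> 6 * (6 * \<bar>t\<bar> - \<bar>l\<bar>) > \<bar>r\<bar> + 2"
    have "6 * (6 * \<bar>t\<bar> - \<bar>l\<bar>) \<le> k * (k * \<bar>t\<bar> - \<bar>l\<bar>)"
      using k * mult_right_mono[OF k, of "\<bar>t\<bar>"] by (intro mult_mono) auto
    also have "\<dots> = \<bar>t * k\<^sup>2\<bar> - \<bar>l * k\<bar>"
      using k by (simp add: abs_mult power2_eq_square algebra_simps)
    also have "\<dots> \<le> \<bar>t * k\<^sup>2 + l * k\<bar>" by linarith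
    finally show ?thesis using * by linarith
  next
    assume *: "t = 0 \<and> 6 * \<bar>l\<bar> > \<bar>r\<bar> + 2"
    then have "6 * \<bar>l\<bar> \<le> \<bar>t * k\<^sup>2 + l * k\<bar>"
      using k mult_right_mono[OF k, of "\<bar>l\<bar>"] by (simp add: abs_mult mult.commute)
    then show ?thesis using * by linarith
  qed
  then show ?thesis by auto
qed

text \<open>\<open>a2\<close> and \<open>c2 - a2\<close> are the amounts by which \<open>x2\<close>
  and \<open>y2\<close> fall short of \<open>k\<close>, likewise for index 3; \<open>t\<close>,
  \<open>l\<close>, \<open>r\<close> are the coefficients of the determinant as a polynomial in
  \<open>k\<close>. All parameters are bounded by the defects, so finitely many tuples are checked.
  In the last alternative the polynomial is constant.\<close>

lemma small_defects:
  fixes c2 c3 a2 a3 s2 s3 :: int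
  assumes c: "(c2, c3) \<in> {(1, 1), (1, 2), (1, 3), (2, 2)}"
    and a: "0 \<le> a2" "a2 \<le> c2" "0 \<le> a3" "a3 \<le> c3"
    and s: "\<bar>s2\<bar> \<le> c2" "even (s2 + c2)" "\<bar>s3\<bar> \<le> c3" "even (s3 + c3)"
    and t: "t = 2 * (s2 - s3)"
    and l: "l = a3 - a2 + (c2 - a2) - (c3 - a3) - s2 * (1 + c3) + s3 * (1 + c2)"
    and r: "r = a2 * (c3 - a3) - a3 * (c2 - a2) + s2 * a3 - s3 * a2"
  shows "(c2, c3, a2, a3, s2, s3) \<in> {(1, 3, 1, 3, 1, 1), (1, 3, 1, 1, - 1, - 1)} \<or>
    6 * \<bar>t\<bar> > \<bar>l\<bar> \<and> 6 * (6 * \<bar>t\<bar> - \<bar>l\<bar>) > \<bar>r\<bar> + 2 \<or> t = 0 \<and> 6 * \<bar>l\<bar> > \<bar>r\<bar> + 2 \<or>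
    t = 0 \<and> l = 0 \<and> \<bar>r\<bar> \<noteq> 2"
proof -
  define admissible where "admissible c2 c3 a2 a3 s2 s3 \<longleftrightarrow>
    (let t = 2 * (s2 - s3);
         l = a3 - a2 + (c2 - a2) - (c3 - a3) - s2 * (1 + c3) + s3 * (1 + c2);
         r = a2 * (c3 - a3) - a3 * (c2 - a2) + s2 * a3 - s3 * a2
     in (c2, c3, a2, a3, s2, s3) \<in> {(1, 3, 1, 3, 1, 1), (1, 3, 1, 1, - 1, - 1)} \<or>
        6 * \<bar>t\<bar> > \<bar>l\<bar> \<and> 6 * (6 * \<bar>t\<bar> - \<bar>l\<bar>) > \<bar>r\<bar> + 2 \<or> t = 0 \<and> 6 * \<bar>l\<bar> > \<bar>r\<bar> + 2 \<or>
        t = 0 \<and> l = 0 \<and> \<bar>r\<bar> \<noteq> 2)" for c2 c3 a2 a3 s2 s3 :: int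
  consider (11) "c2 = 1" "c3 = 1" | (12) "c2 = 1" "c3 = 2" | (13) "c2 = 1" "c3 = 3" | (22) "c2 = 2" "c3 = 2"
    using c by auto
  then have "admissible c2 c3 a2 a3 s2 s3"
  proof cases
    case 11
    have "a2 \<in> {0, 1}" "a3 \<in> {0, 1}" using a 11 by auto
    moreover have "s2 \<in> {- 1, 1} \<and> s3 \<in> {- 1, 1}"
      using s 11 by (simp; presburger)
    moreover have "\<forall>a2 \<in> {0, 1}. \<forall>a3 \<in> {0, 1}. \<forall>s2 \<in> {- 1, 1}. \<forall>s3 \<in> {- 1, 1}. admissible 1 1 a2 a3 s2 s3"
      by (simp add: admissible_def)
    ultimately show ?thesis unfolding 11 by blast
  next
    case 12
    have "a2 \<in> {0, 1}" "a3 \<in> {0, 1, 2}" using a 12 by auto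
    moreover have "s2 \<in> {- 1, 1} \<and> s3 \<in> {- 2, 0, 2}"
      using s 12 by (simp; presburger)
    moreover have "\<forall>a2 \<in> {0, 1}. \<forall>a3 \<in> {0, 1, 2}. \<forall>s2 \<in> {- 1, 1}. \<forall>s3 \<in> {- 2, 0, 2}. admissible 1 2 a2 a3 s2 s3"
      by (simp add: admissible_def)
    ultimately show ?thesis unfolding 12 by blast
  next
    case 13
    have "a2 \<in> {0, 1}" "a3 \<in> {0, 1, 2, 3}" using a 13 by auto
    moreover have "s2 \<in> {- 1, 1} \<and> s3 \<in> {- 3, - 1, 1, 3}"
      using s 13 by (simp; presburger)
    moreover have "\<forall>a2 \<in> {0, 1}. \<forall>a3 \<in> {0, 1, 2, 3}. \<forall>s2 \<in> {- 1, 1}. \<forall>s3 \<in> {- 3, - 1, 1, 3}. admissible 1 3 a2 a3 s2 s3"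
      by (simp add: admissible_def)
    ultimately show ?thesis unfolding 13 by blast
  next
    case 22
    have "a2 \<in> {0, 1, 2}" "a3 \<in> {0, 1, 2}" using a 22 by auto
    moreover have "s2 \<in> {- 2, 0, 2} \<and> s3 \<in> {- 2, 0, 2}"
      using s 22 by (simp; presburger)
    moreover have "\<forall>a2 \<in> {0, 1, 2}. \<forall>a3 \<in> {0, 1, 2}. \<forall>s2 \<in> {- 2, 0, 2}. \<forall>s3 \<in> {- 2, 0, 2}. admissible 2 2 a2 a3 s2 s3"
      by (simp add: admissible_def)
    ultimately show ?thesis unfolding 22 by blast
  qed
  then show ?thesis unfolding admissible_def Let_def t l r .
qed

text \<open>The second alternative satisfies the determinant condition as well; it is discarded below because
  its cross product is shorter than that of the first.\<close>
lemma near_diagonal_solutions: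
  fixes k :: int
  assumes k: "6 \<le> k"
    and x2: "0 \<le> x2" "x2 \<le> k" and y2: "0 \<le> y2" "y2 \<le> k"
    and x3: "0 \<le> x3" "x3 \<le> k" and y3: "0 \<le> y3" "y3 \<le> k"
    and s2: "\<bar>s2\<bar> \<le> 2 * k - x2 - y2" "even (s2 + x2 + y2)"
    and s3: "\<bar>s3\<bar> \<le> 2 * k - x3 - y3" "even (s3 + x3 + y3)"
    and det: "(x2 * y3 - x3 * y2) + s2 * (x3 * (k - 1) + k * y3) - s3 * (k * y2 + x2 * (k - 1)) \<in> {2, -2}"
    and c: "(2 * k - x2 - y2, 2 * k - x3 - y3) \<in> {(1, 1), (1, 2), (1, 3), (2, 2)}"
  shows "x2 = k - 1 \<and> y2 = k \<and> s2 = 1 \<and> x3 = k - 3 \<and> y3 = k \<and> s3 = 1 \<or>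
    x2 = k - 1 \<and> y2 = k \<and> s2 = -1 \<and> x3 = k - 1 \<and> y3 = k - 2 \<and> s3 = -1"
proof -
  define a2 a3 c2 c3 where "a2 = k - x2" and "a3 = k - x3" and "c2 = 2 * k - x2 - y2" and "c3 = 2 * k - x3 - y3"
  then have eqs: "x2 = k - a2" "x3 = k - a3" "y2 = k - (c2 - a2)" "y3 = k - (c3 - a3)" by auto
  define t l r where "t = 2 * (s2 - s3)"
    and "l = a3 - a2 + (c2 - a2) - (c3 - a3) - s2 * (1 + c3) + s3 * (1 + c2)"
    and "r = a2 * (c3 - a3) - a3 * (c2 - a2) + s2 * a3 - s3 * a2"
  have expand: "t * k\<^sup>2 + l * k + r \<in> {2, -2}"
  proof -
    have "t * k\<^sup>2 + l * k + r =
        (x2 * y3 - x3 * y2) + s2 * (x3 * (k - 1) + k * y3) - s3 * (k * y2 + x2 * (k - 1))"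
      unfolding eqs t_def l_def r_def by (simp add: algebra_simps power2_eq_square)
    then show ?thesis using det by simp
  qed
  have a: "0 \<le> a2" "a2 \<le> c2" "0 \<le> a3" "a3 \<le> c3" using x2 y2 x3 y3 by (auto simp: a2_def a3_def c2_def c3_def)
  have s: "\<bar>s2\<bar> \<le> c2" "even (s2 + c2)" "\<bar>s3\<bar> \<le> c3" "even (s3 + c3)"
    using s2 s3 by (auto simp: c2_def c3_def)
  have "(c2, c3) \<in> {(1, 1), (1, 2), (1, 3), (2, 2)}" using c by (simp add: c2_def c3_def)
  from small_defects[OF this a s t_def l_def r_def]
  have "(c2, c3, a2, a3, s2, s3) \<in> {(1, 3, 1, 3, 1, 1), (1, 3, 1, 1, - 1, - 1)}"
    using quadratic_ne_pm2[OF k, of l t r] expand by auto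
  then show ?thesis unfolding eqs by auto
qed

lemma not_in_pm2_if_dvd:
  fixes k t :: int
  assumes "6 \<le> k" "k dvd t"
  shows "t \<notin> {2, -2}"
  using assms zdvd_imp_le[of k 2] by auto

text \<open>The normalised case \<open>x1 = k\<close>, \<open>y1 = k - 1\<close>,
  \<open>s1 = 1\<close>. A vanishing defect makes the determinant a multiple of \<open>k\<close>,
  and \<open>c2 + c3 \<ge> 5\<close> makes the cross product too short. Up to exchanging coordinates
  2 and 3, this leaves the defects of \<open>near_diagonal_solutions\<close>.\<close>

lemma extremal_configuration_near:
  fixes k :: int
  assumes k: "6 \<le> k"
    and x2: "0 \<le> x2" "x2 \<le> k" and y2: "0 \<le> y2" "y2 \<le> k"
    and x3: "0 \<le> x3" "x3 \<le> k" and y3: "0 \<le> y3" "y3 \<le> k"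
    and s2: "\<bar>s2\<bar> \<le> 2 * k - x2 - y2" "even (s2 + x2 + y2)"
    and s3: "\<bar>s3\<bar> \<le> 2 * k - x3 - y3" "even (s3 + x3 + y3)"
    and det: "(x2 * y3 - x3 * y2) + s2 * (x3 * (k - 1) + k * y3) - s3 * (k * y2 + x2 * (k - 1)) \<in> {2, -2}"
    and large: "extremal_sq k \<le> normal_sq (k, k - 1) (x2, y2) (x3, y3)"
  shows "s2 = 1 \<and> s3 = 1 \<and> y2 = k \<and> y3 = k \<and> (x2 = k - 3 \<and> x3 = k - 1 \<or> x2 = k - 1 \<and> x3 = k - 3)"
proof -
  define c2 c3 where "c2 = 2 * k - x2 - y2" and "c3 = 2 * k - x3 - y3"
  have "c2 \<noteq> 0"
  proof
    assume "c2 = 0"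
    then have "x2 = k" "y2 = k" "s2 = 0" using x2 y2 s2 by (auto simp: c2_def)
    then show False
      using det not_in_pm2_if_dvd[OF k, of "k * (y3 - x3 - s3 * (2 * k - 1))"] by (auto simp: algebra_simps)
  qed
  moreover have "c3 \<noteq> 0"
  proof
    assume "c3 = 0"
    then have "x3 = k" "y3 = k" "s3 = 0" using x3 y3 s3 by (auto simp: c3_def)
    then show False
      using det not_in_pm2_if_dvd[OF k, of "k * (x2 - y2 + s2 * (2 * k - 1))"] by (auto simp: algebra_simps)
  qed
  ultimately have pos: "1 \<le> c2" "1 \<le> c3" using x2 x3 y2 y3 by (auto simp: c2_def c3_def)
  have far: "\<not> (d2 \<le> c2 \<and> d3 \<le> c3)" if "(d2, d3) \<in> {(4, 1), (3, 2), (2, 3), (1, 4)}" for d2 d3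
    using normal_sq_less_if_near_diagonal[OF k _ _ that, of "(x2, y2)" "(x3, y3)"] large x2 y2 x3 y3
    by (auto simp: cut_square_def c2_def c3_def)
  have small: "(c2, c3) \<in> {(1, 1), (1, 2), (1, 3), (2, 2)} \<or> (c3, c2) \<in> {(1, 1), (1, 2), (1, 3), (2, 2)}"
  proof -
    have "c2 \<le> 3" "c3 \<le> 3" "\<not> (3 \<le> c2 \<and> 2 \<le> c3)" "\<not> (2 \<le> c2 \<and> 3 \<le> c3)"
      using pos far[of 4 1] far[of 3 2] far[of 2 3] far[of 1 4] by auto
    moreover from this have "c2 \<in> {1, 2, 3}" "c3 \<in> {1, 2, 3}" using pos by auto
    ultimately show ?thesis by auto
  qed
  have spurious: "normal_sq (k, k - 1) (k - 1, k) (k - 1, k - 2) < extremal_sq k"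
  proof -
    have "extremal_sq k - normal_sq (k, k - 1) (k - 1, k) (k - 1, k - 2) = 8 * k * (k - 1) + 4"
      by (simp add: normal_sq_def extremal_sq_def algebra_simps power2_eq_square power3_eq_cube power4_eq_xxxx)
    then show ?thesis using k by (smt (verit) mult_nonneg_nonneg)
  qed
  \<comment> \<open>Exchanging coordinates 2 and 3 negates the determinant, and
    \<open>{2, -2}\<close> is symmetric.\<close>
  have det': "(x3 * y2 - x2 * y3) + s3 * (x2 * (k - 1) + k * y2) - s2 * (k * y3 + x3 * (k - 1)) \<in> {2, -2}"
    using det by (auto simp: algebra_simps)
  from small show ?thesis
  proof
    assume "(c2, c3) \<in> {(1, 1), (1, 2), (1, 3), (2, 2)}"
    then show ?thesis
      using near_diagonal_solutions[OF k x2 y2 x3 y3 s2 s3 det] spurious large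
      by (auto simp: c2_def c3_def)
  next
    assume "(c3, c2) \<in> {(1, 1), (1, 2), (1, 3), (2, 2)}"
    then show ?thesis
      using near_diagonal_solutions[OF k x3 y3 x2 y2 s3 s2 det'] spurious large
      by (auto simp: c2_def c3_def normal_sq_swap[of _ "(k - 1, k - 2)" "(k - 1, k)"])
  qed
qed

text \<open>Here \<open>(s1, s2, s3)\<close> stands for twice the difference of the midpoints of the two edges. This makes
  the hypotheses symmetric under reflection of the cube in its centre, and the determinant below is
  twice the integer in question.\<close>
lemma extremal_configuration:
  fixes k :: int
  assumes k: "6 \<le> k"
    and x1: "0 \<le> x1" "x1 \<le> k" and y1: "0 \<le> y1" "y1 \<le> k"
    and x2: "0 \<le> x2" "x2 \<le> k" and y2: "0 \<le> y2" "y2 \<le> k"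
    and x3: "0 \<le> x3" "x3 \<le> k" and y3: "0 \<le> y3" "y3 \<le> k"
    and s1: "\<bar>s1\<bar> \<le> 2 * k - x1 - y1" "even (s1 + x1 + y1)"
    and s2: "\<bar>s2\<bar> \<le> 2 * k - x2 - y2" "even (s2 + x2 + y2)"
    and s3: "\<bar>s3\<bar> \<le> 2 * k - x3 - y3" "even (s3 + x3 + y3)"
    and det: "s1 * (x2 * y3 - x3 * y2) + s2 * (x3 * y1 + x1 * y3) - s3 * (x1 * y2 + x2 * y1) \<in> {2, -2}"
    and large: "extremal_sq k \<le> normal_sq (x1, y1) (x2, y2) (x3, y3)"
  obtains \<sigma> where "\<sigma> \<in> {1, -1}" "s2 = \<sigma>" "s3 = \<sigma>"
    and "s1 = \<sigma> \<and> x1 = k \<and> y1 = k - 1 \<and> y2 = k \<and> y3 = k \<and>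
        (x2 = k - 3 \<and> x3 = k - 1 \<or> x2 = k - 1 \<and> x3 = k - 3) \<or>
      s1 = - \<sigma> \<and> y1 = k \<and> x1 = k - 1 \<and> x2 = k \<and> x3 = k \<and>
        (y2 = k - 3 \<and> y3 = k - 1 \<or> y2 = k - 1 \<and> y3 = k - 3)"
proof -
  have "\<not> (x1 = k \<and> y1 = k)"
  proof
    assume "x1 = k \<and> y1 = k"
    then have "x1 = k" "y1 = k" "s1 = 0" using s1 by auto
    then show False
      using det not_in_pm2_if_dvd[OF k, of "k * (s2 * (x3 + y3) - s3 * (y2 + x2))"] by (auto simp: algebra_simps)
  qed
  moreover have c2: "\<not> (x2 = k \<and> y2 = k)"
  proof
    assume "x2 = k \<and> y2 = k"
    then have "x2 = k" "y2 = k" "s2 = 0" using s2 by auto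
    then show False
      using det not_in_pm2_if_dvd[OF k, of "k * (s1 * (y3 - x3) - s3 * (x1 + y1))"] by (auto simp: algebra_simps)
  qed
  moreover have c3: "\<not> (x3 = k \<and> y3 = k)"
  proof
    assume "x3 = k \<and> y3 = k"
    then have "x3 = k" "y3 = k" "s3 = 0" using s3 by auto
    then show False
      using det not_in_pm2_if_dvd[OF k, of "k * (s1 * (x2 - y2) + s2 * (x1 + y1))"] by (auto simp: algebra_simps)
  qed
  ultimately have "(x2, y2) \<in> cut_square k 1" "(x3, y3) \<in> cut_square k 1" "x1 + y1 \<noteq> 2 * k"
    using x1 y1 x2 y2 x3 y3 by (auto simp: cut_square_def)
  moreover from this have "\<not> x1 + y1 \<le> 2 * k - 2"
    using normal_sq_less_if_sum_le[OF k, of "(x1, y1)" "(x2, y2)" "(x3, y3)"] large x1 y1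
    by (auto simp: cut_square_def)
  ultimately have "x1 + y1 = 2 * k - 1" using x1 y1 by linarith
  then have xy1: "x1 = k \<and> y1 = k - 1 \<or> x1 = k - 1 \<and> y1 = k" using x1 y1 by auto
  with \<open>x1 + y1 = 2 * k - 1\<close> have "\<bar>s1\<bar> \<le> 1" "odd s1" using s1 by auto
  then have s1': "s1 \<in> {1, -1}" by (cases "s1 = 0") auto
  note near = extremal_configuration_near[OF k]
  \<comment> \<open>Negating \<open>s1\<close>, \<open>s2\<close> and \<open>s3\<close> together
    negates the determinant and keeps the bounds and parities, so the sign of \<open>s1\<close> can
    be switched.\<close>
  have neg: "\<bar>- s2\<bar> \<le> 2 * k - x2 - y2" "even (- s2 + x2 + y2)" "\<bar>- s3\<bar> \<le> 2 * k - x3 - y3" "even (- s3 + x3 + y3)"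
    using s2 s3 by auto
  from xy1 show ?thesis
  proof
    assume xy: "x1 = k \<and> y1 = k - 1"
    from s1' consider (1) "s1 = 1" | (2) "s1 = -1" by auto
    then show ?thesis
    proof cases
      case s1: 1
      have "(x2 * y3 - x3 * y2) + s2 * (x3 * (k - 1) + k * y3) - s3 * (k * y2 + x2 * (k - 1)) \<in> {2, -2}"
        using det s1 xy by (auto simp: algebra_simps)
      moreover have "extremal_sq k \<le> normal_sq (k, k - 1) (x2, y2) (x3, y3)"
        using large xy by simp
      ultimately have "s2 = 1 \<and> s3 = 1 \<and> y2 = k \<and> y3 = k \<and>
          (x2 = k - 3 \<and> x3 = k - 1 \<or> x2 = k - 1 \<and> x3 = k - 3)"
        by (rule near[OF x2 y2 x3 y3 s2 s3])
      then show ?thesis using s1 xy by (intro that[of "1"]) auto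
    next
      case s1: 2
      have "(x2 * y3 - x3 * y2) + (- s2) * (x3 * (k - 1) + k * y3) - (- s3) * (k * y2 + x2 * (k - 1)) \<in> {2, -2}"
        using det s1 xy by (auto simp: algebra_simps)
      moreover have "extremal_sq k \<le> normal_sq (k, k - 1) (x2, y2) (x3, y3)"
        using large xy by simp
      ultimately have "(- s2) = 1 \<and> (- s3) = 1 \<and> y2 = k \<and> y3 = k \<and>
          (x2 = k - 3 \<and> x3 = k - 1 \<or> x2 = k - 1 \<and> x3 = k - 3)"
        by (rule near[OF x2 y2 x3 y3 neg])
      then show ?thesis using s1 xy by (intro that[of "-1"]) auto
    qed
  next
    assume xy: "x1 = k - 1 \<and> y1 = k"
    \<comment> \<open>Exchanging the \<open>x\<close> and \<open>y\<close> extents changes the sign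
      of the \<open>s1\<close> term of the determinant only. Here \<open>s1 = -1\<close> is thus the
      direct case, and \<open>s1 = 1\<close> needs the negation.\<close>
    have swap: "normal_sq (y1, x1) (y2, x2) (y3, x3) = normal_sq (x1, y1) (x2, y2) (x3, y3)"
      by (simp add: normal_sq_def algebra_simps power2_eq_square)
    have s: "\<bar>s2\<bar> \<le> 2 * k - y2 - x2" "even (s2 + y2 + x2)" "\<bar>s3\<bar> \<le> 2 * k - y3 - x3" "even (s3 + y3 + x3)"
      using s2 s3 by (auto simp: algebra_simps)
    have neg': "\<bar>- s2\<bar> \<le> 2 * k - y2 - x2" "even (- s2 + y2 + x2)" "\<bar>- s3\<bar> \<le> 2 * k - y3 - x3" "even (- s3 + y3 + x3)"
      using neg by (auto simp: algebra_simps)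
    from s1' consider (1) "s1 = 1" | (2) "s1 = -1" by auto
    then show ?thesis
    proof cases
      case s1: 1
      have "(y2 * x3 - y3 * x2) + (- s2) * (y3 * (k - 1) + k * x3) - (- s3) * (k * x2 + y2 * (k - 1)) \<in> {2, -2}"
        using det s1 xy by (auto simp: algebra_simps)
      moreover have "extremal_sq k \<le> normal_sq (k, k - 1) (y2, x2) (y3, x3)"
        using large swap xy by simp
      ultimately have "(- s2) = 1 \<and> (- s3) = 1 \<and> x2 = k \<and> x3 = k \<and>
          (y2 = k - 3 \<and> y3 = k - 1 \<or> y2 = k - 1 \<and> y3 = k - 3)"
        by (rule near[OF y2 x2 y3 x3 neg'])
      then show ?thesis using s1 xy by (intro that[of "-1"]) auto
    next
      case s1: 2
      have "(y2 * x3 - y3 * x2) + s2 * (y3 * (k - 1) + k * x3) - s3 * (k * x2 + y2 * (k - 1)) \<in> {2, -2}"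
        using det s1 xy by (auto simp: algebra_simps)
      moreover have "extremal_sq k \<le> normal_sq (k, k - 1) (y2, x2) (y3, x3)"
        using large swap xy by simp
      ultimately have "s2 = 1 \<and> s3 = 1 \<and> x2 = k \<and> x3 = k \<and>
          (y2 = k - 3 \<and> y3 = k - 1 \<or> y2 = k - 1 \<and> y3 = k - 3)"
        by (rule near[OF y2 x2 y3 x3 s])
      then show ?thesis using s1 xy by (intro that[of "1"]) auto
    qed
  qed
qed

subsection \<open>Closest points of convex hulls\<close>

text \<open>While the vectors are dependent, a multiple of a linear relation is subtracted until
  some weight reaches zero, and that vector is dropped. Vectors of weight zero are dropped too;
  strict positivity is what later forces orthogonality to \<open>z\<close>.\<close>

lemma conic_caratheodory:
  fixes T :: "'a::real_vector set"
  assumes "finite T" "\<forall>t\<in>T. 0 \<le> c t"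
  shows "\<exists>S c'. S \<subseteq> T \<and> independent S \<and> (\<forall>t\<in>S. 0 < c' t) \<and>
    (\<Sum>t\<in>S. c' t *\<^sub>R t) = (\<Sum>t\<in>T. c t *\<^sub>R t)"
  using assms
proof (induction T arbitrary: c rule: finite_psubset_induct)
  case (psubset T)
  have drop: ?case if v: "v \<in> T" "d v = 0" and d: "\<forall>t\<in>T. 0 \<le> d t"
    and eq: "(\<Sum>t\<in>T. d t *\<^sub>R t) = (\<Sum>t\<in>T. c t *\<^sub>R t)" for v d
  proof -
    have "(\<Sum>t\<in>T - {v}. d t *\<^sub>R t) = (\<Sum>t\<in>T. d t *\<^sub>R t)"
      using psubset.hyps v by (simp add: sum.remove[of T v])
    moreover have "\<exists>S c'. S \<subseteq> T - {v} \<and> independent S \<and> (\<forall>t\<in>S. 0 < c' t) \<and>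
        (\<Sum>t\<in>S. c' t *\<^sub>R t) = (\<Sum>t\<in>T - {v}. d t *\<^sub>R t)"
      using v d by (intro psubset.IH) auto
    ultimately show ?case using eq by (metis Diff_subset subset_trans)
  qed
  show ?case
  proof (cases "independent T \<and> (\<forall>t\<in>T. c t \<noteq> 0)")
    case True
    then show ?thesis using psubset.prems by (intro exI[of _ T] exI[of _ c]) (auto simp: less_le)
  next
    case False
    show ?thesis
    proof (cases "independent T")
      case True
      then show ?thesis using False drop[of _ c] psubset.prems by auto
    next
      case False
      then obtain u v where "v \<in> T" "u v \<noteq> 0" "(\<Sum>t\<in>T. u t *\<^sub>R t) = 0"
        using dependent_finite[OF psubset.hyps] by auto
      moreover from this have "(\<Sum>t\<in>T. - u t *\<^sub>R t) = 0" by (simp add: sum_negf)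
      \<comment> \<open>Negating the relation if need be provides a positive coefficient.\<close>
      ultimately obtain u v where u: "v \<in> T" "0 < u v" "(\<Sum>t\<in>T. u t *\<^sub>R t) = 0"
        by (metis linorder_neqE_linordered_idom neg_0_less_iff_less)
      define P where "P = {v \<in> T. 0 < u v}"
      \<comment> \<open>The largest multiple of \<open>u\<close> whose subtraction keeps all weights
        nonnegative; the weight of a minimiser becomes zero.\<close>
      define r where "r = Min ((\<lambda>v. c v / u v) ` P)"
      have P: "finite P" "P \<noteq> {}" using psubset.hyps u by (auto simp: P_def)
      then have "r \<in> (\<lambda>v. c v / u v) ` P" unfolding r_def by (intro Min_in) auto
      then obtain v where v: "v \<in> T" "0 < u v" "r = c v / u v" by (auto simp: P_def)
      have "0 \<le> r" using v psubset.prems by simp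
      have le: "r * u t \<le> c t" if "t \<in> T" for t
      proof (cases "0 < u t")
        case True
        then have "r \<le> c t / u t" using P that unfolding r_def by (intro Min_le) (auto simp: P_def)
        then show ?thesis using True by (simp add: field_simps)
      next
        case False
        then have "r * u t \<le> 0" using \<open>0 \<le> r\<close> by (simp add: mult_nonneg_nonpos)
        then show ?thesis using psubset.prems that by force
      qed
      have "(\<Sum>t\<in>T. (c t - r * u t) *\<^sub>R t) = (\<Sum>t\<in>T. c t *\<^sub>R t) - r *\<^sub>R (\<Sum>t\<in>T. u t *\<^sub>R t)"
        by (simp add: algebra_simps sum_subtractf scaleR_sum_right)
      then show ?thesis
        using v le u(3) by (intro drop[of v "\<lambda>t. c t - r * u t"]) auto
    qed
  qed
qed

text \<open>The final condition is linear independence of the lifted vectors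
  \<open>(x, 1, 0)\<close> and \<open>(- y, 0, 1)\<close>. It says more than affine independence of
  \<open>S\<close> and of \<open>T\<close>: if both are edges, these cannot be parallel.\<close>

lemma closest_pair_of_convex_hulls:
  fixes V W :: "(real^3) set"
  assumes V: "finite V" "V \<noteq> {}" and W: "finite W" "W \<noteq> {}"
    and disjoint: "convex hull V \<inter> convex hull W = {}"
  obtains z S T a b where "norm z = setdist (convex hull V) (convex hull W)" "z \<noteq> 0"
    "S \<subseteq> V" "T \<subseteq> W" "card S + card T \<le> 4"
    "sum a S = 1" "sum b T = 1" "z = (\<Sum>x\<in>S. a x *\<^sub>R x) - (\<Sum>y\<in>T. b y *\<^sub>R y)"
    "\<forall>x\<in>S. \<forall>y\<in>T. z \<bullet> (x - y) = z \<bullet> z"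
    "\<forall>\<alpha> \<beta>. sum \<alpha> S = 0 \<and> sum \<beta> T = 0 \<and> (\<Sum>x\<in>S. \<alpha> x *\<^sub>R x) = (\<Sum>y\<in>T. \<beta> y *\<^sub>R y) \<longrightarrow>
       (\<forall>x\<in>S. \<alpha> x = 0) \<and> (\<forall>y\<in>T. \<beta> y = 0)"
proof -
  let ?P = "convex hull V" and ?Q = "convex hull W"
  have compact: "compact ?P" "compact ?Q" using V W by (auto intro: finite_imp_compact_convex_hull)
  then obtain p q where pq: "p \<in> ?P" "q \<in> ?Q" "dist p q = setdist ?P ?Q"
    using setdist_compact_closed[of ?P ?Q] V W by (auto simp: compact_imp_closed)
  define z where "z = p - q"
  have norm_z: "norm z = setdist ?P ?Q" using pq by (simp add: z_def dist_norm)
  have "z \<noteq> 0" using pq disjoint by (auto simp: z_def)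
  have minimal: "dist p q \<le> dist x y" if "x \<in> ?P" "y \<in> ?Q" for x y
    using that pq(3) setdist_le_dist by metis
  have P_side: "0 \<le> z \<bullet> (x - p)" if "x \<in> V" for x
    using any_closest_point_dot[of ?P p x q] compact pq minimal[OF _ pq(2)] that
    by (auto simp: z_def compact_imp_closed hull_inc dist_commute inner_diff_left)
  have Q_side: "z \<bullet> (y - q) \<le> 0" if "y \<in> W" for y
    using any_closest_point_dot[of ?Q q y p] compact pq minimal[OF pq(1)] that
    by (auto simp: z_def compact_imp_closed hull_inc)
  obtain \<alpha> where \<alpha>: "\<And>x. x \<in> V \<Longrightarrow> 0 \<le> \<alpha> x" "sum \<alpha> V = 1" "(\<Sum>x\<in>V. \<alpha> x *\<^sub>R x) = p"
    using pq(1) V by (auto simp: convex_hull_finite)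
  obtain \<beta> where \<beta>: "\<And>x. x \<in> W \<Longrightarrow> 0 \<le> \<beta> x" "sum \<beta> W = 1" "(\<Sum>x\<in>W. \<beta> x *\<^sub>R x) = q"
    using pq(2) W by (auto simp: convex_hull_finite)
  \<comment> \<open>A pair of convex combinations with difference \<open>z\<close> is a conic combination of the vectors \<open>f x\<close> and
    \<open>g y\<close> with value \<open>(z, 1, 1)\<close>. Those with positive weight lie in the hyperplane orthogonal to \<open>N\<close>,
    so at most four of them are needed.\<close>
  define f :: "real^3 \<Rightarrow> (real^3) \<times> real \<times> real" where "f = (\<lambda>x. (x, 1, 0))"
  define g :: "real^3 \<Rightarrow> (real^3) \<times> real \<times> real" where "g = (\<lambda>y. (- y, 0, 1))"
  have inj: "inj_on f A" "inj_on g A" for A by (auto simp: f_def g_def inj_on_def)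
  have fg: "f ` A \<inter> g ` B = {}" for A B by (auto simp: f_def g_def)
  \<comment> \<open>The second component is 1 on the image of \<open>f\<close> and 0 on the image of
    \<open>g\<close>, so it tells the two families apart.\<close>
  define c where "c t = (if fst (snd t) = 1 then \<alpha> (fst t) else \<beta> (- fst t))" for t :: "(real^3) \<times> real \<times> real"
  have sum_fg: "(\<Sum>t\<in>f ` A \<union> g ` B. h t *\<^sub>R t) =
      ((\<Sum>x\<in>A. h (f x) *\<^sub>R x) - (\<Sum>y\<in>B. h (g y) *\<^sub>R y), (\<Sum>x\<in>A. h (f x)), (\<Sum>y\<in>B. h (g y)))"
    if "finite A" "finite B" for A B h
  proof -
    have "(\<Sum>t\<in>f ` A \<union> g ` B. h t *\<^sub>R t) = (\<Sum>x\<in>A. h (f x) *\<^sub>R f x) + (\<Sum>y\<in>B. h (g y) *\<^sub>R g y)"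
      using that by (simp add: sum.union_disjoint fg sum.reindex inj)
    also have "\<dots> = ((\<Sum>x\<in>A. h (f x) *\<^sub>R x) - (\<Sum>y\<in>B. h (g y) *\<^sub>R y), (\<Sum>x\<in>A. h (f x)), (\<Sum>y\<in>B. h (g y)))"
      by (simp add: f_def g_def prod_eq_iff fst_sum snd_sum sum_negf)
    finally show ?thesis .
  qed
  have combination: "(\<Sum>t\<in>f ` V \<union> g ` W. c t *\<^sub>R t) = (z, 1, 1)"
    using \<alpha> \<beta> V W by (simp add: sum_fg c_def z_def) (simp add: f_def g_def)
  have nonneg: "\<forall>t\<in>f ` V \<union> g ` W. 0 \<le> c t"
    using \<alpha> \<beta> by (auto simp: c_def f_def g_def)
  have "finite (f ` V \<union> g ` W)" using V W by simp
  from conic_caratheodory[OF this nonneg] obtain R c'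
    where R: "R \<subseteq> f ` V \<union> g ` W" "independent R" "\<forall>t\<in>R. 0 < c' t"
      and R_sum: "(\<Sum>t\<in>R. c' t *\<^sub>R t) = (z, 1, 1)"
    unfolding combination by (elim exE conjE)
  define S T where "S = {x \<in> V. f x \<in> R}" and "T = {y \<in> W. g y \<in> R}"
  have ST: "S \<subseteq> V" "T \<subseteq> W" "finite S" "finite T" "R = f ` S \<union> g ` T"
    using R(1) V W by (auto simp: S_def T_def)
  have fin: "finite R" using ST by auto
  \<comment> \<open>\<open>N \<bullet> f x = z \<bullet> (x - p)\<close> and
    \<open>N \<bullet> g y = - (z \<bullet> (y - q))\<close> are nonnegative because
    \<open>p\<close> and \<open>q\<close> are closest points, while \<open>N\<close> annihilates
    \<open>(z, 1, 1)\<close>. With positive weights, every term must vanish.\<close>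
  define N where "N = (z, - (z \<bullet> p), z \<bullet> q)"
  have N_nonneg: "0 \<le> N \<bullet> t" if "t \<in> R" for t
    using that R(1) P_side Q_side by (auto simp: N_def f_def g_def inner_diff_right)
  have "N \<bullet> (z, 1, 1) = 0" by (simp add: N_def z_def algebra_simps)
  then have "(\<Sum>t\<in>R. c' t * (N \<bullet> t)) = 0" by (simp flip: R_sum add: inner_sum_right)
  then have orth: "N \<bullet> t = 0" if "t \<in> R" for t
    using that fin R(3) N_nonneg sum_nonneg_eq_0_iff[of R "\<lambda>t. c' t * (N \<bullet> t)"]
    by (force simp: less_imp_le)
  have "N \<noteq> 0" using \<open>z \<noteq> 0\<close> by (auto simp: N_def zero_prod_def)
  have "card R \<le> dim {t. N \<bullet> t = 0}"
    using orth R(2) by (intro independent_card_le_dim) auto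
  \<comment> \<open>The lifted space has dimension 3 + 1 + 1 = 5.\<close>
  also have "\<dots> = 4" using dim_hyperplane[OF \<open>N \<noteq> 0\<close>] by simp
  finally have "card R \<le> 4" .
  moreover have "card R = card S + card T"
    using ST by (simp add: card_Un_disjoint fg card_image inj)
  moreover have "((\<Sum>x\<in>S. c' (f x) *\<^sub>R x) - (\<Sum>y\<in>T. c' (g y) *\<^sub>R y), (\<Sum>x\<in>S. c' (f x)), (\<Sum>y\<in>T. c' (g y))) = (z, 1, 1)"
    using sum_fg[of S T c'] ST R_sum by simp
  moreover have "z \<bullet> (x - y) = z \<bullet> z" if "x \<in> S" "y \<in> T" for x y
    using orth[of "f x"] orth[of "g y"] ST that by (simp add: N_def f_def g_def z_def inner_diff_right)
  moreover have "\<forall>\<alpha> \<beta>. sum \<alpha> S = 0 \<and> sum \<beta> T = 0 \<and> (\<Sum>x\<in>S. \<alpha> x *\<^sub>R x) = (\<Sum>y\<in>T. \<beta> y *\<^sub>R y) \<longrightarrow>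
      (\<forall>x\<in>S. \<alpha> x = 0) \<and> (\<forall>y\<in>T. \<beta> y = 0)"
  proof (intro allI impI)
    fix \<alpha> \<beta>
    assume that: "sum \<alpha> S = 0 \<and> sum \<beta> T = 0 \<and> (\<Sum>x\<in>S. \<alpha> x *\<^sub>R x) = (\<Sum>y\<in>T. \<beta> y *\<^sub>R y)"
    define h where "h t = (if fst (snd t) = 1 then \<alpha> (fst t) else \<beta> (- fst t))" for t :: "(real^3) \<times> real \<times> real"
    have h: "h (f x) = \<alpha> x" "h (g x) = \<beta> x" for x by (auto simp: h_def f_def g_def)
    then have "(\<Sum>t\<in>R. h t *\<^sub>R t) = 0" using that ST by (simp add: sum_fg zero_prod_def)
    then have "h t = 0" if "t \<in> R" for t using independentD[OF R(2) fin subset_refl _ that] by blast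
    then show "(\<forall>x\<in>S. \<alpha> x = 0) \<and> (\<forall>y\<in>T. \<beta> y = 0)" using h ST by (metis UnCI imageI)
  qed
  ultimately show thesis
    using norm_z \<open>z \<noteq> 0\<close> ST(1,2)
    by (intro that[of z S T "\<lambda>x. c' (f x)" "\<lambda>y. c' (g y)"]) (simp_all add: prod_eq_iff)
qed

subsection \<open>Distances between lattice polytopes\<close>

lemma integer_lattice_diff: "x \<in> integer_lattice \<Longrightarrow> y \<in> integer_lattice \<Longrightarrow> x - y \<in> integer_lattice"
  by (simp add: integer_lattice_def)


lemma integer_lattice_cross: "x \<in> integer_lattice \<Longrightarrow> y \<in> integer_lattice \<Longrightarrow> x \<times> y \<in> integer_lattice"
  by (simp add: integer_lattice_def cross3_def forall_3)

lemma integer_lattice_inner: "x \<in> integer_lattice \<Longrightarrow> y \<in> integer_lattice \<Longrightarrow> x \<bullet> y \<in> \<int>"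
  by (auto simp: integer_lattice_def inner_vec_def intro!: Ints_sum)

lemma one_le_norm_sq_if_lattice:
  assumes "x \<in> integer_lattice" "x \<noteq> 0"
  shows "1 \<le> (norm x)\<^sup>2"
  using integer_lattice_inner[OF assms(1,1)] assms(2)
  by (auto simp: power2_norm_eq_inner elim!: Ints_cases) (metis inner_gt_zero_iff of_int_0_less_iff int_one_le_iff_zero_less)

lemma norm_sq_3: "(norm x)\<^sup>2 = (x $ 1)\<^sup>2 + (x $ 2)\<^sup>2 + (x $ 3)\<^sup>2" for x :: "real^3"
  unfolding power2_norm_eq_inner by (simp add: inner_vec_def sum_3 power2_eq_square)

text \<open>\<open>z\<close> is parallel to \<open>u \<times> v\<close>, and it is the component of
  \<open>w\<close> in that direction. For lattice vectors this makes the distance a nonzero integer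
  divided by the length of a cross product.\<close>

lemma perpendicular_norm:
  fixes u v w z :: "real^3"
  assumes "z \<bullet> u = 0" "z \<bullet> v = 0" "z \<bullet> w = z \<bullet> z" "z \<noteq> 0" "u \<times> v \<noteq> 0"
  shows "(norm z)\<^sup>2 * (norm (u \<times> v))\<^sup>2 = (w \<bullet> (u \<times> v))\<^sup>2" "w \<bullet> (u \<times> v) \<noteq> 0"
proof -
  have "z \<times> (u \<times> v) = 0"
    using assms(1,2) by (simp add: Lagrange)
  then obtain c where c: "u \<times> v = c *\<^sub>R z"
    using assms(4,5) by (auto simp: cross_eq_0 collinear_lemma)
  then have eqs: "(norm (u \<times> v))\<^sup>2 = c\<^sup>2 * (z \<bullet> z)" "w \<bullet> (u \<times> v) = c * (z \<bullet> z)"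
    using assms(3) by (simp_all add: power_mult_distrib inner_commute[of w] power2_norm_eq_inner)
  then show "(norm z)\<^sup>2 * (norm (u \<times> v))\<^sup>2 = (w \<bullet> (u \<times> v))\<^sup>2" "w \<bullet> (u \<times> v) \<noteq> 0"
    unfolding eqs unfolding power2_norm_eq_inner using assms(4,5) c by (auto simp: power2_eq_square)
qed

text \<open>Twice the area of a triangle in a square of side \<open>k\<close>. It is at most
  \<open>k\<close> times the sum of the positive parts of the cyclic differences of the
  \<open>b\<close> values, and that sum is the spread of these values.\<close>

lemma triangle_area_le:
  fixes k :: real
  assumes "a1 \<in> {0..k}" "a2 \<in> {0..k}" "a3 \<in> {0..k}" "b1 \<in> {0..k}" "b2 \<in> {0..k}" "b3 \<in> {0..k}"
  shows "\<bar>(a2 - a1) * (b3 - b1) - (a3 - a1) * (b2 - b1)\<bar> \<le> k\<^sup>2"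
proof -
  have *: "(a2 - a1) * (b3 - b1) - (a3 - a1) * (b2 - b1) \<le> k\<^sup>2"
    if a: "a1 \<in> {0..k}" "a2 \<in> {0..k}" "a3 \<in> {0..k}" and b: "b1 \<in> {0..k}" "b2 \<in> {0..k}" "b3 \<in> {0..k}"
    for a1 a2 a3 b1 b2 b3 :: real
  proof -
    have part: "a * b \<le> k * max b 0" if "a \<in> {0..k}" for a b
      using that by (cases "0 \<le> b") (auto simp: max_def mult_right_mono mult_nonneg_nonpos)
    have "(a2 - a1) * (b3 - b1) - (a3 - a1) * (b2 - b1) = a1 * (b2 - b3) + a2 * (b3 - b1) + a3 * (b1 - b2)"
      by (simp add: algebra_simps)
    also have "\<dots> \<le> k * (max (b2 - b3) 0 + max (b3 - b1) 0 + max (b1 - b2) 0)"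
      using part[OF a(1), of "b2 - b3"] part[OF a(2), of "b3 - b1"] part[OF a(3), of "b1 - b2"]
      by (simp add: algebra_simps)
    also have "\<dots> \<le> k * k"
      using b by (intro mult_left_mono) (auto simp: max_def)
    finally show ?thesis by (simp add: power2_eq_square)
  qed
  from *[of a1 a2 a3 b1 b2 b3] *[of a1 a3 a2 b1 b3 b2] assms show ?thesis by (auto simp: abs_le_iff algebra_simps)
qed

lemma hypercubeD: "x \<in> hypercube k \<Longrightarrow> x $ i \<in> {0..real k}"
  by (simp add: hypercube_def)

lemma sq_le_if_abs_le: "\<bar>x\<bar> \<le> y \<Longrightarrow> x\<^sup>2 \<le> y\<^sup>2" for x y :: real
  using power_mono[of "\<bar>x\<bar>" y 2] by simp

text \<open>Up to sign, the coordinates of the cross product are twice the areas of the projected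
  triangles. The crude bound \<open>9 * k ^ 4\<close> would exceed
  \<open>extremal_sq\<close>.\<close>

lemma norm_cross_triangle_le:
  fixes x1 x2 x3 :: "real^3"
  assumes "x1 \<in> hypercube k" "x2 \<in> hypercube k" "x3 \<in> hypercube k"
  shows "(norm ((x2 - x1) \<times> (x3 - x1)))\<^sup>2 \<le> 3 * real k ^ 4"
proof -
  have "\<bar>(x2 $ i - x1 $ i) * (x3 $ j - x1 $ j) - (x3 $ i - x1 $ i) * (x2 $ j - x1 $ j)\<bar> \<le> (real k)\<^sup>2" for i j
    using triangle_area_le[of "x1 $ i" "real k" "x2 $ i" "x3 $ i" "x1 $ j" "x2 $ j" "x3 $ j"]
      assms[THEN hypercubeD] by blast
  from sq_le_if_abs_le[OF this] have sq: "((x2 $ i - x1 $ i) * (x3 $ j - x1 $ j) - (x3 $ i - x1 $ i) * (x2 $ j - x1 $ j))\<^sup>2 \<le> real k ^ 4" for i j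
    by (simp flip: power_mult)
  show ?thesis
    using sq[of 2 3] sq[of 3 1] sq[of 1 2] by (simp add: norm_sq_3 cross3_def algebra_simps)
qed

lemma norm_sq_diff_le:
  fixes x y :: "real^3"
  assumes "x \<in> hypercube k" "y \<in> hypercube k"
  shows "(norm (x - y))\<^sup>2 \<le> 3 * (real k)\<^sup>2"
proof -
  have "\<bar>x $ i - y $ i\<bar> \<le> real k" for i
    using hypercubeD[OF assms(1), of i] hypercubeD[OF assms(2), of i] by auto
  from sq_le_if_abs_le[OF this] show ?thesis
    unfolding norm_sq_3 by (simp add: add_mono)
      (smt (verit) sq_le_if_abs_le)
qed

text \<open>A crude bound from Lagrange's identity. It suffices when the integer in the numerator is
  at least 2 in absolute value, since the comparison is then with four times
  \<open>extremal_sq\<close>.\<close>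

lemma norm_cross_segments_le:
  fixes x1 x2 y1 y2 :: "real^3"
  assumes "x1 \<in> hypercube k" "x2 \<in> hypercube k" "y1 \<in> hypercube k" "y2 \<in> hypercube k"
  shows "(norm ((x2 - x1) \<times> (y2 - y1)))\<^sup>2 \<le> 9 * real k ^ 4"
proof -
  have "(norm ((x2 - x1) \<times> (y2 - y1)))\<^sup>2 \<le> (norm (x2 - x1))\<^sup>2 * (norm (y2 - y1))\<^sup>2"
    using norm_cross_dot[of "x2 - x1" "y2 - y1"] by (simp add: power_mult_distrib) (smt (verit) zero_le_power2)
  also have "\<dots> \<le> (3 * (real k)\<^sup>2) * (3 * (real k)\<^sup>2)"
    using assms by (intro mult_mono norm_sq_diff_le) auto
  finally show ?thesis by (simp flip: power_add)
qed

text \<open>In this order, the bounds discard vertex against triangle, vertex against edge, two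
  edges with determinant other than 1 or -1, and vertex against vertex.\<close>

lemma extremal_sq_bounds:
  assumes "6 \<le> k"
  shows "3 * real k ^ 4 < real_of_int (extremal_sq (int k))"
    and "3 * (real k)\<^sup>2 < real_of_int (extremal_sq (int k))"
    and "9 * real k ^ 4 < 4 * real_of_int (extremal_sq (int k))"
    and "1 < real_of_int (extremal_sq (int k))"
proof -
  define j where "j = real k - 6"
  have j: "real k = 6 + j" and "0 \<le> j" using assms by (auto simp: j_def)
  then have nonneg: "0 \<le> j" "0 \<le> j * j" "0 \<le> j * (j * j)" "0 \<le> j * (j * (j * j))" by auto
  have *: "real_of_int (extremal_sq (int k)) =
      8 * real k ^ 4 - 24 * real k ^ 3 + 40 * (real k)\<^sup>2 - 28 * real k + 10"
    by (simp add: extremal_sq_def)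
  show "3 * real k ^ 4 < real_of_int (extremal_sq (int k))"
    unfolding * j
    by (simp add: algebra_simps power2_eq_square power3_eq_cube power4_eq_xxxx; insert nonneg; linarith)
  show sq: "3 * (real k)\<^sup>2 < real_of_int (extremal_sq (int k))"
    unfolding * j
    by (simp add: algebra_simps power2_eq_square power3_eq_cube power4_eq_xxxx; insert nonneg; linarith)
  show "9 * real k ^ 4 < 4 * real_of_int (extremal_sq (int k))"
    unfolding * j
    by (simp add: algebra_simps power2_eq_square power3_eq_cube power4_eq_xxxx; insert nonneg; linarith)
  have "36 \<le> (real k)\<^sup>2" using power_mono[of 6 "real k" 2] assms by simp
  with sq show "1 < real_of_int (extremal_sq (int k))" by linarith
qed

lemma one_le_sq_if_Ints: "t \<in> \<int> \<Longrightarrow> t \<noteq> 0 \<Longrightarrow> 1 \<le> t\<^sup>2" for t :: real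
proof (elim Ints_cases)
  fix i assume "t \<noteq> 0" "t = of_int i"
  then have "1 \<le> i\<^sup>2" by (simp add: int_one_le_iff_zero_less)
  then have "real_of_int 1 \<le> real_of_int (i\<^sup>2)" by (simp only: of_int_le_iff)
  then show ?thesis using \<open>t = of_int i\<close> by simp
qed

lemma four_le_sq_if_Ints: "t \<in> \<int> \<Longrightarrow> t \<noteq> 0 \<Longrightarrow> \<bar>t\<bar> \<noteq> 1 \<Longrightarrow> 4 \<le> t\<^sup>2" for t :: real
proof (elim Ints_cases)
  fix i assume "t \<noteq> 0" "\<bar>t\<bar> \<noteq> 1" and t: "t = of_int i"
  then have "i \<noteq> 0" "i \<noteq> 1" "i \<noteq> - 1" by auto
  then have "\<bar>2\<bar> \<le> \<bar>t\<bar>" unfolding t by linarith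
  then show ?thesis using abs_le_square_iff[of 2 t] by simp
qed

lemma cross_eq_zeroE:
  fixes u v :: "real^3"
  assumes "u \<times> v = 0" "u \<noteq> 0" "v \<noteq> 0"
  obtains c where "v = c *\<^sub>R u"
  using assms by (auto simp: cross_eq_0 collinear_lemma)

section \<open>Distance bounds according to the sizes of \<open>S\<close> and
  \<open>T\<close>\<close>

text \<open>For one, two or three vertices there is a nonzero integral quantity of size
  \<open>norm z\<close> times 1, the length of the edge, or the length of a normal of the triangle.
  Its square is at least 1, whereas the squared factor is below \<open>extremal_sq\<close>.\<close>

lemma vertex_distance:
  fixes S :: "(real^3) set"
  assumes k: "6 \<le> k" and S: "S \<subseteq> integer_lattice" "S \<subseteq> hypercube k" and card: "card S \<le> 3"
    and y: "y \<in> integer_lattice" "y \<in> hypercube k"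
    and a: "sum a S = 1" and z: "z = (\<Sum>x\<in>S. a x *\<^sub>R x) - y" "z \<noteq> 0"
    and perp: "\<And>x. x \<in> S \<Longrightarrow> z \<bullet> (x - y) = z \<bullet> z"
    and indep: "\<And>\<alpha>. sum \<alpha> S = 0 \<Longrightarrow> (\<Sum>x\<in>S. \<alpha> x *\<^sub>R x) = 0 \<Longrightarrow> \<forall>x\<in>S. \<alpha> x = 0"
  shows "1 < (norm z)\<^sup>2 * real_of_int (extremal_sq (int k))"
proof -
  let ?M = "real_of_int (extremal_sq (int k))"
  note M = extremal_sq_bounds[OF k]
  have norm_z: "0 < (norm z)\<^sup>2" using z(2) by simp
  have bound: ?thesis if "1 \<le> (norm z)\<^sup>2 * t" "t < ?M" for t
    using mult_strict_left_mono[OF that(2) norm_z] that(1) by linarith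
  have "S \<noteq> {}" "finite S" using a by (auto intro: ccontr[of "finite S"])
  then have "1 \<le> card S" by (simp add: Suc_le_eq card_gt_0_iff)
  then consider "card S = 1" | "card S = 2" | "card S = 3" using card by linarith
  then show ?thesis
  proof cases
    case 1
    then obtain x where x: "S = {x}" using card_1_singletonE by blast
    then have "z = x - y" using a z by simp
    then show ?thesis
      using bound[of 1] M one_le_norm_sq_if_lattice[of z] z(2) x S y by (simp add: integer_lattice_diff)
  next
    case 2
    then obtain x1 x2 where x: "S = {x1, x2}" "x1 \<noteq> x2" by (auto simp: card_2_iff)
    define u where "u = x2 - x1"
    have "a x1 = 1 - a x2" using a x by simp
    then have "z = (1 - a x2) *\<^sub>R x1 + a x2 *\<^sub>R x2 - y" using z x by simp
    then have "z = x1 - y + a x2 *\<^sub>R u" by (simp add: u_def algebra_simps)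
    then have "z \<times> u = (x1 - y) \<times> u" by (simp add: cross_add_left cross_mult_left)
    then have lattice: "z \<times> u \<in> integer_lattice"
      using x S y by (simp add: u_def integer_lattice_cross integer_lattice_diff)
    have "z \<bullet> u = 0" using perp[of x1] perp[of x2] x by (simp add: u_def inner_diff_right)
    then have eq: "(norm (z \<times> u))\<^sup>2 = (norm z)\<^sup>2 * (norm u)\<^sup>2"
      using norm_cross_dot[of z u] by (simp add: power_mult_distrib)
    moreover have "u \<noteq> 0" using x by (simp add: u_def)
    ultimately have "z \<times> u \<noteq> 0" using z(2) by auto
    then have "1 \<le> (norm z)\<^sup>2 * (norm u)\<^sup>2"
      using one_le_norm_sq_if_lattice[OF lattice] eq by simp
    moreover have "(norm u)\<^sup>2 \<le> 3 * (real k)\<^sup>2" using S x by (simp add: u_def norm_sq_diff_le)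
    ultimately show ?thesis using bound[of "(norm u)\<^sup>2"] M by linarith
  next
    case 3
    then obtain x1 x2 x3 where x: "S = {x1, x2, x3}" "x1 \<noteq> x2" "x1 \<noteq> x3" "x2 \<noteq> x3"
      by (auto simp: card_3_iff)
    define n where "n = (x2 - x1) \<times> (x3 - x1)"
    have "n \<noteq> 0"
    proof
      assume "n = 0"
      then obtain c where c: "x3 - x1 = c *\<^sub>R (x2 - x1)"
        unfolding n_def using x by (elim cross_eq_zeroE) auto
      \<comment> \<open>Collinearity of the three points as an affine relation with coefficient 1 at
        \<open>x3\<close>.\<close>
      let ?\<alpha> = "\<lambda>x. if x = x1 then c - 1 else if x = x2 then - c else 1"
      have "sum ?\<alpha> S = 0" "(\<Sum>x\<in>S. ?\<alpha> x *\<^sub>R x) = 0"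
        using x c by (simp_all add: algebra_simps)
      then have "\<forall>x\<in>S. ?\<alpha> x = 0" by (rule indep)
      then have "?\<alpha> x3 = 0" unfolding x by blast
      then show False using x by simp
    qed
    moreover have "z \<bullet> (x2 - x1) = 0" "z \<bullet> (x3 - x1) = 0" "z \<bullet> (x1 - y) = z \<bullet> z"
      using perp[of x1] perp[of x2] perp[of x3] x by (simp_all add: inner_diff_right)
    ultimately have "(norm z)\<^sup>2 * (norm n)\<^sup>2 = ((x1 - y) \<bullet> n)\<^sup>2" "(x1 - y) \<bullet> n \<noteq> 0"
      using perpendicular_norm[of z "x2 - x1" "x3 - x1" "x1 - y"] z(2) by (auto simp: n_def)
    moreover have "(x1 - y) \<bullet> n \<in> \<int>"
      using S y x by (simp add: n_def integer_lattice_inner integer_lattice_cross integer_lattice_diff)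
    ultimately have "1 \<le> (norm z)\<^sup>2 * (norm n)\<^sup>2" using one_le_sq_if_Ints by metis
    moreover have "(norm n)\<^sup>2 \<le> 3 * real k ^ 4" using S x by (simp add: n_def norm_cross_triangle_le)
    ultimately show ?thesis using bound[of "(norm n)\<^sup>2"] M by linarith
  qed
qed

text \<open>At most four vertices leave either a single vertex on one side, where
  \<open>vertex_distance\<close> applies, or two edges. An integer other than 1 or -1, or a cross
  product that is too short, makes the distance of two edges too large; the second alternative is
  what remains.\<close>

lemma lattice_hulls_distance:
  fixes V W :: "(real^3) set"
  assumes k: "6 \<le> k"
    and V: "finite V" "V \<noteq> {}" "V \<subseteq> integer_lattice" "V \<subseteq> hypercube k"
    and W: "finite W" "W \<noteq> {}" "W \<subseteq> integer_lattice" "W \<subseteq> hypercube k"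
    and disjoint: "convex hull V \<inter> convex hull W = {}"
  defines "d \<equiv> (setdist (convex hull V) (convex hull W))\<^sup>2 * real_of_int (extremal_sq (int k))"
  shows "1 < d \<or> (\<exists>x1\<in>V. \<exists>x2\<in>V. \<exists>y1\<in>W. \<exists>y2\<in>W.
    \<bar>(x1 - y1) \<bullet> ((x2 - x1) \<times> (y2 - y1))\<bar> = 1 \<and>
    real_of_int (extremal_sq (int k)) \<le> (norm ((x2 - x1) \<times> (y2 - y1)))\<^sup>2 \<and>
    (setdist (convex hull V) (convex hull W))\<^sup>2 * (norm ((x2 - x1) \<times> (y2 - y1)))\<^sup>2 = 1)"
proof -
  let ?M = "real_of_int (extremal_sq (int k))"
  note M = extremal_sq_bounds[OF k]
  obtain z S T a b where z: "norm z = setdist (convex hull V) (convex hull W)" "z \<noteq> 0"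
    and ST: "S \<subseteq> V" "T \<subseteq> W" "card S + card T \<le> 4"
    and ab: "sum a S = 1" "sum b T = 1" "z = (\<Sum>x\<in>S. a x *\<^sub>R x) - (\<Sum>y\<in>T. b y *\<^sub>R y)"
    and perp: "\<forall>x\<in>S. \<forall>y\<in>T. z \<bullet> (x - y) = z \<bullet> z"
    and indep: "\<forall>\<alpha> \<beta>. sum \<alpha> S = 0 \<and> sum \<beta> T = 0 \<and> (\<Sum>x\<in>S. \<alpha> x *\<^sub>R x) = (\<Sum>y\<in>T. \<beta> y *\<^sub>R y) \<longrightarrow>
      (\<forall>x\<in>S. \<alpha> x = 0) \<and> (\<forall>y\<in>T. \<beta> y = 0)"
    by (rule closest_pair_of_convex_hulls[OF V(1,2) W(1,2) disjoint])
  have d: "d = (norm z)\<^sup>2 * ?M" by (simp add: d_def z)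
  have fin: "finite S" "finite T" using ST V W by (auto intro: finite_subset)
  have "S \<noteq> {}" "T \<noteq> {}" using ab by auto
  then have "card S \<ge> 1" "card T \<ge> 1" using fin by (simp_all add: Suc_le_eq card_gt_0_iff)
  then consider "card T = 1" "card S \<le> 3" | "card S = 1" "card T \<le> 3" | "card S = 2" "card T = 2"
    using ST(3) by linarith
  then show ?thesis
  proof cases
    case 1
    then obtain y where y: "T = {y}" using card_1_singletonE by blast
    have "1 < (norm z)\<^sup>2 * ?M"
    proof (rule vertex_distance[OF k _ _ 1(2) _ _ ab(1)])
      show "\<forall>x\<in>S. \<alpha> x = 0" if "sum \<alpha> S = 0" "(\<Sum>x\<in>S. \<alpha> x *\<^sub>R x) = 0" for \<alpha>
        using indep[rule_format, of \<alpha> "\<lambda>_. 0"] that by simp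
    qed (use ST V W y ab perp z in auto)
    then show ?thesis using d by simp
  next
    case 2
    then obtain x where x: "S = {x}" using card_1_singletonE by blast
    have "1 < (norm (- z))\<^sup>2 * ?M"
    proof (rule vertex_distance[OF k _ _ 2(2) _ _ ab(2)])
      show "\<forall>x\<in>T. \<alpha> x = 0" if "sum \<alpha> T = 0" "(\<Sum>x\<in>T. \<alpha> x *\<^sub>R x) = 0" for \<alpha>
        using indep[rule_format, of "\<lambda>_. 0" \<alpha>] that by simp
      show "- z \<bullet> (y - x) = - z \<bullet> - z" if "y \<in> T" for y
        using perp[rule_format, of x y] that x by (simp add: inner_diff_right)
    qed (use ST V W x ab z in auto)
    then show ?thesis using d by simp
  next
    case 3
    then obtain x1 x2 y1 y2 where x: "S = {x1, x2}" "x1 \<noteq> x2" and y: "T = {y1, y2}" "y1 \<noteq> y2"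
      by (auto simp: card_2_iff)
    define n where "n = (x2 - x1) \<times> (y2 - y1)"
    have "n \<noteq> 0"
    proof
      assume "n = 0"
      then obtain c where c: "y2 - y1 = c *\<^sub>R (x2 - x1)"
        unfolding n_def using x y by (elim cross_eq_zeroE) auto
      \<comment> \<open>Parallel edges yield a relation that the independence condition
        forbids.\<close>
      let ?\<alpha> = "\<lambda>x. if x = x1 then - c else c" and ?\<beta> = "\<lambda>y. if y = y1 then - 1 else 1 :: real"
      have "sum ?\<alpha> S = 0" "sum ?\<beta> T = 0" "(\<Sum>x\<in>S. ?\<alpha> x *\<^sub>R x) = (\<Sum>y\<in>T. ?\<beta> y *\<^sub>R y)"
        using x y c by (simp_all add: algebra_simps)
      then have "\<forall>y\<in>T. ?\<beta> y = 0" using indep[rule_format, of ?\<alpha> ?\<beta>] by blast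
      then have "?\<beta> y1 = 0" unfolding y by blast
      then show False by simp
    qed
    moreover have "z \<bullet> (x2 - x1) = 0" "z \<bullet> (y2 - y1) = 0" "z \<bullet> (x1 - y1) = z \<bullet> z"
      using perp[rule_format, of x1 y1] perp[rule_format, of x2 y1] perp[rule_format, of x1 y2] x y by (simp_all add: inner_diff_right)
    ultimately have det: "(norm z)\<^sup>2 * (norm n)\<^sup>2 = ((x1 - y1) \<bullet> n)\<^sup>2" "(x1 - y1) \<bullet> n \<noteq> 0"
      using perpendicular_norm[of z "x2 - x1" "y2 - y1" "x1 - y1"] z(2) by (auto simp: n_def)
    have xy: "x1 \<in> V" "x2 \<in> V" "y1 \<in> W" "y2 \<in> W" using ST x y by auto
    then have lattice: "(x1 - y1) \<bullet> n \<in> \<int>"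
      using V W by (auto simp: n_def intro!: integer_lattice_inner integer_lattice_cross integer_lattice_diff)
    have norm_z: "0 < (norm z)\<^sup>2" using z(2) by simp
    show ?thesis
    proof (cases "\<bar>(x1 - y1) \<bullet> n\<bar> = 1")
      case True
      then have one: "(norm z)\<^sup>2 * (norm n)\<^sup>2 = 1" using det by (metis power2_abs one_power2)
      show ?thesis
      proof (cases "?M \<le> (norm n)\<^sup>2")
        case True
        then show ?thesis using \<open>\<bar>(x1 - y1) \<bullet> n\<bar> = 1\<close> one xy unfolding z(1) n_def by blast
      next
        case False
        then show ?thesis using one d mult_strict_left_mono[OF _ norm_z, of "(norm n)\<^sup>2" ?M] by simp
      qed
    next
      case False
      then have "4 \<le> ((x1 - y1) \<bullet> n)\<^sup>2"
        using four_le_sq_if_Ints[OF lattice] det(2) by blast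
      then have "4 \<le> (norm z)\<^sup>2 * (norm n)\<^sup>2" using det by simp
      moreover have "(norm n)\<^sup>2 \<le> 9 * real k ^ 4"
        using xy V W by (auto simp: n_def intro!: norm_cross_segments_le)
      ultimately have "4 < (norm z)\<^sup>2 * (4 * ?M)"
        using M(3) mult_strict_left_mono[OF _ norm_z, of "(norm n)\<^sup>2" "4 * ?M"] by linarith
      then show ?thesis using d by simp
    qed
  qed
qed

subsection \<open>Symmetries of the cube\<close>

lemma cube_symmetryD:
  assumes "f \<in> cube_symmetries k"
  shows "dist (f x) (f y) = dist x y" "f x \<in> hypercube k \<longleftrightarrow> x \<in> hypercube k" "inj f"
proof -
  show *: "dist (f x) (f y) = dist x y" for x y using assms by (simp add: cube_symmetries_def)
  show inj: "inj f"
  proof (rule injI)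
    fix x y assume "f x = f y" then show "x = y" using *[of x y] by simp
  qed
  have "f ` hypercube k = hypercube k" using assms by (simp add: cube_symmetries_def)
  then show "f x \<in> hypercube k \<longleftrightarrow> x \<in> hypercube k" using inj by (metis inj_image_mem_iff)
qed

lemma cube_symmetry_affine:
  fixes f :: "real^'n \<Rightarrow> real^'n"
  assumes "f \<in> cube_symmetries k"
  obtains g where "orthogonal_transformation g" "\<And>x. f x = f 0 + g x"
proof -
  have "orthogonal_transformation (\<lambda>x. f x - f 0)"
    using cube_symmetryD(1)[OF assms] unfolding orthogonal_transformation_isometry
    by (simp add: dist_norm)
  then show thesis by (intro that[of "\<lambda>x. f x - f 0"]) auto
qed

lemma cube_symmetry_segment:
  fixes f :: "real^'n \<Rightarrow> real^'n"
  assumes "f \<in> cube_symmetries k"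
  shows "f ` closed_segment a b = closed_segment (f a) (f b)"
proof -
  obtain g where g: "orthogonal_transformation g" "\<And>x. f x = f 0 + g x"
    by (rule cube_symmetry_affine[OF assms]) blast
  have "f ` closed_segment a b = (+) (f 0) ` g ` closed_segment a b"
    by (subst image_image) (simp flip: g(2))
  also have "\<dots> = closed_segment (f 0 + g a) (f 0 + g b)"
    using g(1) by (simp add: closed_segment_translation closed_segment_linear_image orthogonal_transformation_linear)
  finally show ?thesis by (simp flip: g(2))
qed

lemma cube_symmetry_comp: "f \<in> cube_symmetries k \<Longrightarrow> g \<in> cube_symmetries k \<Longrightarrow> f \<circ> g \<in> cube_symmetries k"
  unfolding cube_symmetries_def by (simp flip: image_image add: image_comp[symmetric])

lemma id_cube_symmetry: "id \<in> cube_symmetries k"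
  by (simp add: cube_symmetries_def)

lemma involution_cube_symmetry:
  assumes "\<And>x y. dist (f x) (f y) = dist x y" "\<And>x. x \<in> hypercube k \<Longrightarrow> f x \<in> hypercube k" "\<And>x. f (f x) = x"
  shows "f \<in> cube_symmetries k"
  unfolding cube_symmetries_def using assms by (auto intro!: image_eqI[of _ f "f _"])

definition reflect :: "nat \<Rightarrow> 'n set \<Rightarrow> real^'n \<Rightarrow> real^'n" where
  "reflect k I x = (\<chi> i. if i \<in> I then real k - x $ i else x $ i)"

definition permute :: "('n \<Rightarrow> 'n) \<Rightarrow> real^'n \<Rightarrow> real^'n" where
  "permute \<pi> x = (\<chi> i. x $ \<pi> i)"

lemma reflect_reflect [simp]: "reflect k I (reflect k I x) = x"
  by (simp add: reflect_def vec_eq_iff)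

lemma reflect_cube_symmetry: "reflect k I \<in> cube_symmetries k"
proof (rule involution_cube_symmetry)
  show "dist (reflect k I x) (reflect k I y) = dist x y" for x y
    by (simp add: dist_vec_def reflect_def dist_real_def cong: if_cong)
      (intro arg_cong2[where f = L2_set] ext, auto)
qed (auto simp: reflect_def hypercube_def vec_eq_iff)

lemma permute_permute: "(\<And>i. \<pi> (\<pi> i) = i) \<Longrightarrow> permute \<pi> (permute \<pi> x) = x"
  by (simp add: permute_def vec_eq_iff)

lemma permute_cube_symmetry:
  fixes \<pi> :: "'n::finite \<Rightarrow> 'n"
  assumes "\<And>i. \<pi> (\<pi> i) = i"
  shows "permute \<pi> \<in> cube_symmetries k"
proof (rule involution_cube_symmetry)
  have "bij \<pi>" using assms by (rule involuntory_imp_bij)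
  then show "dist (permute \<pi> x) (permute \<pi> y) = dist x y" for x y :: "real^'n"
    unfolding dist_vec_def permute_def L2_set_def by (simp add: sum.reindex_bij_betw[of \<pi> UNIV UNIV "\<lambda>i. (dist (x $ i) (y $ i))\<^sup>2"])
qed (use assms in \<open>auto simp: permute_permute permute_def hypercube_def\<close>)

text \<open>The linear part is orthogonal and commutes with the cross product up to its determinant,
  which is 1 or -1; hence the absolute value around the triple product.\<close>

lemma cube_symmetry_cross:
  fixes f :: "real^3 \<Rightarrow> real^3"
  assumes "f \<in> cube_symmetries k"
  shows "norm ((f b - f a) \<times> (f d - f c)) = norm ((b - a) \<times> (d - c))"
    and "\<bar>(f a - f c) \<bullet> ((f b - f a) \<times> (f d - f c))\<bar> = \<bar>(a - c) \<bullet> ((b - a) \<times> (d - c))\<bar>"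
proof -
  obtain g where g: "orthogonal_transformation g" "\<And>x. f x = f 0 + g x"
    by (rule cube_symmetry_affine[OF assms]) blast
  have diff: "f x - f y = g (x - y)" for x y
    using g by (metis add_diff_cancel_left linear_diff orthogonal_transformation_linear)
  have det: "\<bar>det (matrix g)\<bar> = 1" using g(1) orthogonal_transformation_det by blast
  show "norm ((f b - f a) \<times> (f d - f c)) = norm ((b - a) \<times> (d - c))"
    unfolding diff using g(1) det
    by (simp add: cross_orthogonal_transformation orthogonal_transformation_norm)
  show "\<bar>(f a - f c) \<bullet> ((f b - f a) \<times> (f d - f c))\<bar> = \<bar>(a - c) \<bullet> ((b - a) \<times> (d - c))\<bar>"
    unfolding diff using g(1) det
    by (simp add: cross_orthogonal_transformation orthogonal_transformation_def abs_mult)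
qed

text \<open>A metric description of the vertices of the cube, hence one that isometries preserve.\<close>
lemma hypercube_opposite_vertices:
  fixes x y :: "real^'n"
  assumes "x \<in> hypercube k" "y \<in> hypercube k" "(dist x y)\<^sup>2 = real CARD('n) * (real k)\<^sup>2"
  shows "x $ i \<in> {0, real k}"
proof -
  have le: "(dist (x $ i) (y $ i))\<^sup>2 \<le> (real k)\<^sup>2" for i
    using hypercubeD[OF assms(1), of i] hypercubeD[OF assms(2), of i]
    by (intro power_mono) (auto simp: dist_real_def)
  have "(dist x y)\<^sup>2 = (\<Sum>i\<in>UNIV. (dist (x $ i) (y $ i))\<^sup>2)"
    by (simp add: dist_vec_def L2_set_def sum_nonneg)
  then have "(\<Sum>i\<in>UNIV. (real k)\<^sup>2 - (dist (x $ i) (y $ i))\<^sup>2) = 0"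
    using assms(3) by (simp add: sum_subtractf)
  then have "(real k)\<^sup>2 - (dist (x $ i) (y $ i))\<^sup>2 = 0"
    using le by (subst (asm) sum_nonneg_eq_0_iff) auto
  then have "(x $ i - y $ i)\<^sup>2 = (real k)\<^sup>2" by (simp add: dist_real_def)
  then have "x $ i - y $ i = real k \<or> x $ i - y $ i = - real k" by (simp only: power2_eq_iff)
  then show ?thesis
    using hypercubeD[OF assms(1), of i] hypercubeD[OF assms(2), of i] by auto
qed

text \<open>A vertex and its antipode realise the diameter of the cube, hence so do their
  images.\<close>

lemma cube_symmetry_vertex:
  fixes f :: "real^'n \<Rightarrow> real^'n"
  assumes f: "f \<in> cube_symmetries k" and x: "\<And>i. x $ i \<in> {0, real k}"
  shows "f x $ i \<in> {0, real k}"
proof (rule hypercube_opposite_vertices)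
  let ?y = "reflect k UNIV x"
  have "0 \<le> x $ i \<and> x $ i \<le> real k" for i using x[of i] by auto
  then have "x \<in> hypercube k" "?y \<in> hypercube k" by (auto simp: hypercube_def reflect_def)
  then show "f x \<in> hypercube k" "f ?y \<in> hypercube k" by (simp_all add: cube_symmetryD(2)[OF f])
  have "(dist (x $ i) (?y $ i))\<^sup>2 = (real k)\<^sup>2" for i
    using x[of i] by (auto simp: reflect_def dist_real_def)
  then show "(dist (f x) (f ?y))\<^sup>2 = real CARD('n) * (real k)\<^sup>2"
    unfolding cube_symmetryD(1)[OF f] by (simp add: dist_vec_def L2_set_def sum_nonneg)
qed

text \<open>Vertices go to vertices, so \<open>k\<close> times a column of the linear part is a
  difference of two vectors with entries 0 and \<open>k\<close>. The matrix of the linear part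
  therefore has entries 0, 1 and -1.\<close>

lemma cube_symmetry_lattice:
  fixes f :: "real^'n \<Rightarrow> real^'n"
  assumes f: "f \<in> cube_symmetries k" and "0 < k" and x: "x \<in> integer_lattice"
  shows "f x \<in> integer_lattice"
proof -
  obtain g where g: "orthogonal_transformation g" "\<And>x. f x = f 0 + g x"
    by (rule cube_symmetry_affine[OF f]) blast
  then have lin: "linear g" by (simp add: orthogonal_transformation_linear)
  have f0: "f 0 $ i \<in> {0, real k}" for i by (rule cube_symmetry_vertex[OF f]) simp
  have "g (axis j 1) $ i \<in> \<int>" for i j
  proof -
    have "f (real k *\<^sub>R axis j 1) $ i \<in> {0, real k}"
      by (rule cube_symmetry_vertex[OF f]) (simp add: axis_def)
    moreover have "f (real k *\<^sub>R axis j 1) $ i = f 0 $ i + real k * g (axis j 1) $ i"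
      using g(2)[of "real k *\<^sub>R axis j 1"] lin by (simp add: linear_scale)
    ultimately have cases: "real k * g (axis j 1) $ i = real k * 0 \<or> real k * g (axis j 1) $ i = real k * 1 \<or>
        real k * g (axis j 1) $ i = real k * (- 1)"
      using f0[of i] by auto
    have "real k \<noteq> 0" using \<open>0 < k\<close> by simp
    then have "g (axis j 1) $ i \<in> {0, 1, - 1}" using cases unfolding mult_left_cancel[OF \<open>real k \<noteq> 0\<close>] by simp
    then show ?thesis by auto
  qed
  moreover have "g x = (\<Sum>j\<in>UNIV. x $ j *\<^sub>R g (axis j 1))"
    using lin by (subst basis_expansion[of x, symmetric]) (simp add: linear_sum linear_scale scalar_mult_eq_scaleR)
  moreover have "x $ j \<in> \<int>" for j using x by (simp add: integer_lattice_def)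
  ultimately have "g x $ i \<in> \<int>" for i by (auto intro!: Ints_sum)
  moreover have "f 0 $ i \<in> \<int>" for i using f0[of i] by auto
  ultimately show ?thesis unfolding integer_lattice_def by (simp add: g(2)[of x])
qed

section \<open>Normal form of extremal pairs of edges\<close>

text \<open>The exact norm is included because \<open>extremal_pair\<close> provides only a lower
  bound for it; the disjunction makes the notion independent of the order of the two
  segments.\<close>

definition star_like :: "nat \<Rightarrow> real^3 \<Rightarrow> real^3 \<Rightarrow> real^3 \<Rightarrow> real^3 \<Rightarrow> bool" where
  "star_like k a b c d \<longleftrightarrow>
     (norm ((b - a) \<times> (d - c)))\<^sup>2 = real_of_int (extremal_sq (int k)) \<and>
     (\<exists>f \<in> cube_symmetries k.
        f ` P_star k = closed_segment a b \<and> f ` Q_star k = closed_segment c d \<or>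
        f ` P_star k = closed_segment c d \<and> f ` Q_star k = closed_segment a b)"

lemma norm_cross_flip:
  fixes a b c d :: "real^3"
  shows "norm ((a - b) \<times> (d - c)) = norm ((b - a) \<times> (d - c))"
    "norm ((b - a) \<times> (c - d)) = norm ((b - a) \<times> (d - c))"
    "norm ((d - c) \<times> (b - a)) = norm ((b - a) \<times> (d - c))"
  by (metis cross_minus_left minus_diff_eq norm_minus_cancel)
    (metis cross_minus_right minus_diff_eq norm_minus_cancel, metis cross_skew norm_minus_cancel)

lemma star_like_flip:
  "star_like k b a c d \<longleftrightarrow> star_like k a b c d"
  "star_like k a b d c \<longleftrightarrow> star_like k a b c d"
  "star_like k c d a b \<longleftrightarrow> star_like k a b c d"
  by (auto simp: star_like_def norm_cross_flip closed_segment_commute)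

text \<open>Carries the property back from a normalised position. All normalising maps are
  reflections and transpositions, so involutions suffice and no inverses are needed.\<close>

lemma star_like_symmetry:
  assumes f: "f \<in> cube_symmetries k" "\<And>x. f (f x) = x" and "star_like k (f a) (f b) (f c) (f d)"
  shows "star_like k a b c d"
proof -
  obtain h where h: "h \<in> cube_symmetries k"
    "h ` P_star k = closed_segment (f a) (f b) \<and> h ` Q_star k = closed_segment (f c) (f d) \<or>
     h ` P_star k = closed_segment (f c) (f d) \<and> h ` Q_star k = closed_segment (f a) (f b)"
    using assms(3) by (auto simp: star_like_def)
  have comp: "(f \<circ> h) ` A = closed_segment x y" if "h ` A = closed_segment (f x) (f y)" for A x y
    unfolding image_comp[symmetric] that by (simp add: cube_symmetry_segment[OF f(1)] f(2))
  have "(f \<circ> h) ` P_star k = closed_segment a b \<and> (f \<circ> h) ` Q_star k = closed_segment c d \<or>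
      (f \<circ> h) ` P_star k = closed_segment c d \<and> (f \<circ> h) ` Q_star k = closed_segment a b"
    using h(2) comp by metis
  then have "\<exists>g \<in> cube_symmetries k. g ` P_star k = closed_segment a b \<and> g ` Q_star k = closed_segment c d \<or>
        g ` P_star k = closed_segment c d \<and> g ` Q_star k = closed_segment a b"
    using cube_symmetry_comp[OF f(1) h(1)] by (rule bexI)
  moreover have "(norm ((b - a) \<times> (d - c)))\<^sup>2 = real_of_int (extremal_sq (int k))"
    using assms(3) cube_symmetry_cross(1)[OF f(1), of b a d c] by (simp add: star_like_def)
  ultimately show ?thesis by (simp add: star_like_def)
qed

text \<open>The pairs of edges left over by \<open>lattice_hulls_distance\<close>; the four points
  span a tetrahedron of volume 1/6.\<close>

definition extremal_pair :: "nat \<Rightarrow> real^3 \<Rightarrow> real^3 \<Rightarrow> real^3 \<Rightarrow> real^3 \<Rightarrow> bool" where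
  "extremal_pair k a b c d \<longleftrightarrow> {a, b, c, d} \<subseteq> integer_lattice \<inter> hypercube k \<and>
     \<bar>(a - c) \<bullet> ((b - a) \<times> (d - c))\<bar> = 1 \<and>
     real_of_int (extremal_sq (int k)) \<le> (norm ((b - a) \<times> (d - c)))\<^sup>2"

lemma extremal_pair_symmetry:
  assumes "f \<in> cube_symmetries k" "0 < k" "extremal_pair k a b c d"
  shows "extremal_pair k (f a) (f b) (f c) (f d)"
  using assms(3) cube_symmetry_lattice[OF assms(1,2)] cube_symmetryD(2)[OF assms(1)]
  by (simp add: extremal_pair_def cube_symmetry_cross[OF assms(1)])

lemma extremal_pair_flip:
  assumes "extremal_pair k a b c d"
  shows "extremal_pair k b a c d"
proof -
  have "(b - c) \<bullet> ((a - b) \<times> (d - c)) = - ((a - c) \<bullet> ((b - a) \<times> (d - c)))"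
    by (simp add: cross3_simps)
  then show ?thesis using assms by (auto simp: extremal_pair_def norm_cross_flip)
qed

lemma star_like_base:
  fixes a b c d :: "real^3"
  assumes "a $ 1 = real k" "a $ 2 = 2" "a $ 3 = 1" "b $ 1 = 0" "b $ 2 = real k - 1" "b $ 3 = real k"
    and "c $ 1 = 0" "c $ 2 = 0" "c $ 3 = 0" "d $ 1 = real k - 1" "d $ 2 = real k" "d $ 3 = real k"
  shows "star_like k a b c d"
proof -
  have "a = vector [real k, 2, 1]" "b = vector [0, real k - 1, real k]" "c = 0" "d = vector [real k - 1, real k, real k]"
    using assms by (simp_all add: vec_eq_iff forall_3)
  then have "id ` P_star k = closed_segment a b" "id ` Q_star k = closed_segment c d"
    by (simp_all add: P_star_def Q_star_def)
  moreover have "(norm ((b - a) \<times> (d - c)))\<^sup>2 = real_of_int (extremal_sq (int k))"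
    unfolding norm_sq_3
    by (simp add: cross3_def assms extremal_sq_def algebra_simps power2_eq_square power3_eq_cube power4_eq_xxxx)
  ultimately show ?thesis unfolding star_like_def using id_cube_symmetry by blast
qed

definition star_coordinates :: "nat \<Rightarrow> 3 \<Rightarrow> 3 \<Rightarrow> real^3 \<Rightarrow> real^3 \<Rightarrow> real^3 \<Rightarrow> real^3 \<Rightarrow> bool" where
  "star_coordinates k i j a b c d \<longleftrightarrow>
     a $ 1 = real k \<and> a $ i = 2 \<and> a $ j = 1 \<and> b $ 1 = 0 \<and> b $ i = real k - 1 \<and> b $ j = real k \<and>
     c $ 1 = 0 \<and> c $ i = 0 \<and> c $ j = 0 \<and> d $ 1 = real k - 1 \<and> d $ i = real k \<and> d $ j = real k"

lemma star_coordinates_imp_star_like: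
  assumes "star_coordinates k 2 3 a b c d \<or> star_coordinates k 3 2 a b c d"
  shows "star_like k a b c d"
  using assms
proof
  assume "star_coordinates k 2 3 a b c d"
  then show ?thesis by (intro star_like_base) (auto simp: star_coordinates_def)
next
  assume *: "star_coordinates k 3 2 a b c d"
  let ?\<pi> = "Transposition.transpose (2::3) 3"
  have "?\<pi> 1 = 1" by (simp add: Transposition.transpose_def)
  then have "star_like k (permute ?\<pi> a) (permute ?\<pi> b) (permute ?\<pi> c) (permute ?\<pi> d)"
    using * by (intro star_like_base) (auto simp: star_coordinates_def permute_def)
  then show ?thesis
    by (rule star_like_symmetry[rotated 2]) (simp_all add: permute_cube_symmetry permute_permute)
qed

text \<open>In each coordinate one of the edges spans the full side. This fixes its end points, and
  the midpoint difference then fixes those of the other edge. The two values of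
  \<open>\<sigma>\<close> are exchanged by reflection in the centre of the cube.\<close>

lemma star_like_if_directions:
  fixes a b c d :: "real^3"
  assumes cube: "{a, b, c, d} \<subseteq> hypercube k" and \<sigma>: "\<sigma> = 1 \<or> \<sigma> = - 1"
    and "a $ 1 - b $ 1 = real k" "d $ 1 - c $ 1 = real k - 1" "d $ 2 - c $ 2 = real k" "d $ 3 - c $ 3 = real k"
    and "b $ 2 - a $ 2 = real k - 3 \<and> b $ 3 - a $ 3 = real k - 1 \<or>
      b $ 2 - a $ 2 = real k - 1 \<and> b $ 3 - a $ 3 = real k - 3"
    and "a $ 1 + b $ 1 - c $ 1 - d $ 1 = \<sigma>" "a $ 2 + b $ 2 - c $ 2 - d $ 2 = \<sigma>" "a $ 3 + b $ 3 - c $ 3 - d $ 3 = \<sigma>"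
  shows "star_like k a b c d"
proof -
  have range: "0 \<le> x $ i \<and> x $ i \<le> real k" if "x \<in> {a, b, c, d}" for x i
    using cube that by (auto simp: hypercube_def)
  have bounds: "0 \<le> a $ i" "a $ i \<le> real k" "0 \<le> b $ i" "b $ i \<le> real k"
      "0 \<le> c $ i" "c $ i \<le> real k" "0 \<le> d $ i" "d $ i \<le> real k" for i
    using range[of _ i] by auto
  note facts = bounds[of 1] bounds[of 2] bounds[of 3] assms(3-10)
  from \<sigma> show ?thesis
  proof
    assume [simp]: "\<sigma> = 1"
    have "star_coordinates k 2 3 a b c d \<or> star_coordinates k 3 2 a b c d"
      using facts unfolding star_coordinates_def by simp linarith
    then show ?thesis by (rule star_coordinates_imp_star_like)
  next
    assume [simp]: "\<sigma> = - 1"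
    let ?r = "reflect k (UNIV :: 3 set)"
    \<comment> \<open>The central reflection reverses both directions, hence the exchanged end
      points.\<close>
    have "star_coordinates k 2 3 (?r b) (?r a) (?r d) (?r c) \<or> star_coordinates k 3 2 (?r b) (?r a) (?r d) (?r c)"
      using facts unfolding star_coordinates_def reflect_def by simp linarith
    then have "star_like k (?r a) (?r b) (?r c) (?r d)"
      using star_coordinates_imp_star_like star_like_flip by blast
    then show ?thesis by (rule star_like_symmetry[OF reflect_cube_symmetry reflect_reflect])
  qed
qed

lemma oriented_extremal_pair_imp_star_like:
  assumes k: "6 \<le> k" and pair: "extremal_pair k a b c d"
    and le: "c $ 1 \<le> d $ 1" "c $ 2 \<le> d $ 2" "c $ 3 \<le> d $ 3" "b $ 1 \<le> a $ 1" "a $ 2 \<le> b $ 2" "a $ 3 \<le> b $ 3"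
  shows "star_like k a b c d"
proof -
  have int: "x $ i \<in> \<int>" if "x \<in> {a, b, c, d}" for x i
    using pair that by (auto simp: extremal_pair_def integer_lattice_def)
  define A B C D where "A i = \<lfloor>a $ i\<rfloor>" and "B i = \<lfloor>b $ i\<rfloor>" and "C i = \<lfloor>c $ i\<rfloor>" and "D i = \<lfloor>d $ i\<rfloor>" for i
  then have coords: "a $ i = real_of_int (A i)" "b $ i = real_of_int (B i)"
      "c $ i = real_of_int (C i)" "d $ i = real_of_int (D i)" for i
    using int[of _ i] by (auto elim!: Ints_cases)
  have cube: "{a, b, c, d} \<subseteq> hypercube k" using pair by (auto simp: extremal_pair_def)
  then have range: "0 \<le> A i \<and> A i \<le> int k" "0 \<le> B i \<and> B i \<le> int k" "0 \<le> C i \<and> C i \<le> int k" "0 \<le> D i \<and> D i \<le> int k" for i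
    by (auto simp: hypercube_def coords) (metis of_int_le_iff of_int_of_nat_eq)+
  have leI: "C 1 \<le> D 1" "C 2 \<le> D 2" "C 3 \<le> D 3" "B 1 \<le> A 1" "A 2 \<le> B 2" "A 3 \<le> B 3"
    using le by (simp_all add: coords)
  define x1 x2 x3 where "x1 = A 1 - B 1" and "x2 = B 2 - A 2" and "x3 = B 3 - A 3"
  define y1 y2 y3 where "y1 = D 1 - C 1" and "y2 = D 2 - C 2" and "y3 = D 3 - C 3"
  define s where "s i = A i + B i - C i - D i" for i
  note defs = x1_def x2_def x3_def y1_def y2_def y3_def s_def
  let ?det = "s 1 * (x2 * y3 - x3 * y2) + s 2 * (x3 * y1 + x1 * y3) - s 3 * (x1 * y2 + x2 * y1)"
  define e where "e = ?det"
  \<comment> \<open>The sum \<open>a + b - c - d\<close> is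
    \<open>2 * (a - c) + (b - a) - (d - c)\<close>, and the last two vectors are orthogonal to the
    cross product.\<close>
  have "real_of_int e = 2 * ((a - c) \<bullet> ((b - a) \<times> (d - c)))"
    by (simp add: cross3_def inner_vec_def sum_3 coords e_def defs algebra_simps)
  then have "\<bar>real_of_int e\<bar> = 2" using pair by (simp add: extremal_pair_def abs_mult)
  then have "e \<in> {2, - 2}" by (auto simp: abs_if split: if_splits)
  then have det: "?det \<in> {2, - 2}" by (simp only: e_def)
  have "real_of_int (normal_sq (x1, y1) (x2, y2) (x3, y3)) = (norm ((b - a) \<times> (d - c)))\<^sup>2"
    unfolding norm_sq_3
    by (simp add: cross3_def normal_sq_def coords defs algebra_simps power2_eq_square)
  then have large: "extremal_sq (int k) \<le> normal_sq (x1, y1) (x2, y2) (x3, y3)"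
    using pair by (simp add: extremal_pair_def flip: of_int_le_iff)
  obtain \<sigma> where \<sigma>: "\<sigma> \<in> {1, -1}" "s 2 = \<sigma>" "s 3 = \<sigma>"
    and cases: "s 1 = \<sigma> \<and> x1 = int k \<and> y1 = int k - 1 \<and> y2 = int k \<and> y3 = int k \<and>
        (x2 = int k - 3 \<and> x3 = int k - 1 \<or> x2 = int k - 1 \<and> x3 = int k - 3) \<or>
      s 1 = - \<sigma> \<and> y1 = int k \<and> x1 = int k - 1 \<and> x2 = int k \<and> x3 = int k \<and>
        (y2 = int k - 3 \<and> y3 = int k - 1 \<or> y2 = int k - 1 \<and> y3 = int k - 3)"
  proof (rule extremal_configuration[OF _ _ _ _ _ _ _ _ _ _ _ _ _ _ _ _ _ _ _ det large])
    show "even (s 1 + x1 + y1)" "even (s 2 + x2 + y2)" "even (s 3 + x3 + y3)" by (simp_all add: defs)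
  qed (use k leI range[of 1] range[of 2] range[of 3] in \<open>auto simp: defs\<close>)
  from cases show ?thesis
  proof
    assume *: "s 1 = \<sigma> \<and> x1 = int k \<and> y1 = int k - 1 \<and> y2 = int k \<and> y3 = int k \<and>
        (x2 = int k - 3 \<and> x3 = int k - 1 \<or> x2 = int k - 1 \<and> x3 = int k - 3)"
    then have "real_of_int x1 = real k" "real_of_int y1 = real k - 1" "real_of_int y2 = real k" "real_of_int y3 = real k"
        "real_of_int x2 = real k - 3 \<and> real_of_int x3 = real k - 1 \<or> real_of_int x2 = real k - 1 \<and> real_of_int x3 = real k - 3"
        "real_of_int (s 1) = real_of_int \<sigma>" "real_of_int (s 2) = real_of_int \<sigma>" "real_of_int (s 3) = real_of_int \<sigma>"
        "real_of_int \<sigma> = 1 \<or> real_of_int \<sigma> = - 1"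
      using \<sigma> by auto
    then show ?thesis
      unfolding defs by (intro star_like_if_directions[OF cube, of "real_of_int \<sigma>"]) (simp_all add: coords)
  next
    assume *: "s 1 = - \<sigma> \<and> y1 = int k \<and> x1 = int k - 1 \<and> x2 = int k \<and> x3 = int k \<and>
        (y2 = int k - 3 \<and> y3 = int k - 1 \<or> y2 = int k - 1 \<and> y3 = int k - 3)"
    then have real: "real_of_int y1 = real k" "real_of_int x1 = real k - 1" "real_of_int x2 = real k" "real_of_int x3 = real k"
        "real_of_int y2 = real k - 3 \<and> real_of_int y3 = real k - 1 \<or> real_of_int y2 = real k - 1 \<and> real_of_int y3 = real k - 3"
        "real_of_int (s 1) = - real_of_int \<sigma>" "real_of_int (s 2) = real_of_int \<sigma>" "real_of_int (s 3) = real_of_int \<sigma>"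
        "- real_of_int \<sigma> = 1 \<or> - real_of_int \<sigma> = - 1"
      using \<sigma> by auto
    \<comment> \<open>Exchanging the two edges and reflecting coordinate 1 leads back to the first
      alternative, with \<open>- \<sigma>\<close> in place of \<open>\<sigma>\<close>.\<close>
    let ?r = "reflect k {1 :: 3}"
    have cube': "{?r c, ?r d, ?r a, ?r b} \<subseteq> hypercube k"
      using cube by (simp add: cube_symmetryD(2)[OF reflect_cube_symmetry])
    have "star_like k (?r c) (?r d) (?r a) (?r b)"
      using real unfolding defs
      by (intro star_like_if_directions[OF cube', of "- real_of_int \<sigma>"]) (simp_all add: coords reflect_def)
    then have "star_like k (?r a) (?r b) (?r c) (?r d)" by (simp add: star_like_flip)
    then show ?thesis by (rule star_like_symmetry[OF reflect_cube_symmetry reflect_reflect])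
  qed
qed

text \<open>Each coordinate of the cross product is a difference of two numbers between 0 and
  \<open>r ^ 2\<close>. This excludes extremal pairs in which both edges increase in all
  coordinates.\<close>

lemma norm_cross_nonneg_le:
  fixes u v :: "real^3"
  assumes "\<And>i. 0 \<le> u $ i \<and> u $ i \<le> r" "\<And>i. 0 \<le> v $ i \<and> v $ i \<le> r"
  shows "(norm (u \<times> v))\<^sup>2 \<le> 3 * r ^ 4"
proof -
  have le: "u $ i * v $ j \<le> r\<^sup>2" "0 \<le> u $ i * v $ j" for i j
    using assms(1)[of i] assms(2)[of j] mult_mono[of "u $ i" r "v $ j" r] by (auto simp: power2_eq_square)
  have "\<bar>u $ i * v $ j - u $ j * v $ i\<bar> \<le> r\<^sup>2" for i j
    using le[of i j] le[of j i] by linarith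
  from sq_le_if_abs_le[OF this] have sq: "(u $ i * v $ j - u $ j * v $ i)\<^sup>2 \<le> r ^ 4" for i j
    by (simp flip: power_mult)
  show ?thesis
    using sq[of 2 3] sq[of 3 1] sq[of 1 2] by (simp add: norm_sq_3 cross3_def algebra_simps)
qed

text \<open>Reflections make \<open>d - c\<close> nonnegative. Up to reversing the first edge,
  \<open>b - a\<close> then has all coordinates nonnegative, which its short cross product excludes,
  or at most one coordinate that is negative, which a transposition moves to position 1.\<close>

lemma extremal_pair_imp_star_like:
  assumes k: "6 \<le> k" and pair: "extremal_pair k a b c d"
  shows "star_like k a b c d"
proof -
  have not_monotone: False if "extremal_pair k a b c d" "\<And>i. c $ i \<le> d $ i" "\<And>i. a $ i \<le> b $ i" for a b c d
  proof -
    have "{a, b, c, d} \<subseteq> hypercube k" using that(1) by (auto simp: extremal_pair_def)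
    then have range: "0 \<le> x $ i \<and> x $ i \<le> real k" if "x \<in> {a, b, c, d}" for x i
      using that by (auto simp: hypercube_def)
    have "(norm ((b - a) \<times> (d - c)))\<^sup>2 \<le> 3 * real k ^ 4"
    proof (rule norm_cross_nonneg_le)
      show "0 \<le> (b - a) $ i \<and> (b - a) $ i \<le> real k" for i
        using that(3)[of i] range[of a i] range[of b i] by auto
      show "0 \<le> (d - c) $ i \<and> (d - c) $ i \<le> real k" for i
        using that(2)[of i] range[of c i] range[of d i] by auto
    qed
    then show False using that(1) extremal_sq_bounds(1)[OF k] by (simp add: extremal_pair_def)
  qed
  have one_negative: "star_like k a b c d"
    if pair: "extremal_pair k a b c d" and "\<And>i. c $ i \<le> d $ i" "b $ i \<le> a $ i" "\<And>j. j \<noteq> i \<Longrightarrow> a $ j \<le> b $ j" for a b c d i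
  proof -
    define \<pi> where "\<pi> = Transposition.transpose 1 i"
    have \<pi>: "\<pi> (\<pi> j) = j" "\<pi> 1 = i" "\<pi> j = i \<longleftrightarrow> j = 1" for j
      by (auto simp: \<pi>_def Transposition.transpose_def)
    have "star_like k (permute \<pi> a) (permute \<pi> b) (permute \<pi> c) (permute \<pi> d)"
    proof (rule oriented_extremal_pair_imp_star_like[OF k])
      show "extremal_pair k (permute \<pi> a) (permute \<pi> b) (permute \<pi> c) (permute \<pi> d)"
        using k by (intro extremal_pair_symmetry[OF _ _ pair] permute_cube_symmetry \<pi>) simp
      have "\<pi> 2 \<noteq> i" "\<pi> 3 \<noteq> i" by (simp_all only: \<pi>(3)) simp_all
      then show "permute \<pi> a $ 2 \<le> permute \<pi> b $ 2" "permute \<pi> a $ 3 \<le> permute \<pi> b $ 3"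
        using that(4) by (simp_all add: permute_def)
    qed (simp_all add: permute_def that(2,3) \<pi>(2))
    then show ?thesis
      by (rule star_like_symmetry[rotated 2]) (simp_all add: permute_cube_symmetry permute_permute \<pi>)
  qed
  have aligned: "star_like k a b c d" if pair: "extremal_pair k a b c d" and le: "\<And>i. c $ i \<le> d $ i" for a b c d
  proof -
    note flipped = extremal_pair_flip[OF pair]
    have ex_3: "(\<exists>i::3. R i) \<longleftrightarrow> R 1 \<or> R 2 \<or> R 3" for R by (metis exhaust_3)
    have "(\<forall>i. a $ i \<le> b $ i) \<or> (\<forall>i. b $ i \<le> a $ i) \<or>
        (\<exists>i. b $ i \<le> a $ i \<and> (\<forall>j. j \<noteq> i \<longrightarrow> a $ j \<le> b $ j)) \<or>
        (\<exists>i. a $ i \<le> b $ i \<and> (\<forall>j. j \<noteq> i \<longrightarrow> b $ j \<le> a $ j))"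
      using linear[of "a $ 1" "b $ 1"] linear[of "a $ 2" "b $ 2"] linear[of "a $ 3" "b $ 3"]
      unfolding ex_3 forall_3 by simp blast
    then consider "\<forall>i. a $ i \<le> b $ i" | "\<forall>i. b $ i \<le> a $ i"
      | i where "b $ i \<le> a $ i" "\<forall>j. j \<noteq> i \<longrightarrow> a $ j \<le> b $ j"
      | i where "a $ i \<le> b $ i" "\<forall>j. j \<noteq> i \<longrightarrow> b $ j \<le> a $ j"
      by blast
    then show ?thesis
    proof cases
      case 1
      then show ?thesis using not_monotone[OF pair le] by blast
    next
      case 2
      then show ?thesis using not_monotone[OF flipped le] by blast
    next
      case (3 i)
      then show ?thesis using one_negative[OF pair le] by blast
    next
      case (4 i)
      then show ?thesis using one_negative[OF flipped le] star_like_flip(1) by blast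
    qed
  qed
  let ?r = "reflect k {i. d $ i < c $ i}"
  have "star_like k (?r a) (?r b) (?r c) (?r d)"
  proof (rule aligned)
    show "extremal_pair k (?r a) (?r b) (?r c) (?r d)"
      using k by (intro extremal_pair_symmetry[OF reflect_cube_symmetry _ pair]) simp
    show "?r c $ i \<le> ?r d $ i" for i by (simp add: reflect_def)
  qed
  then show ?thesis by (rule star_like_symmetry[OF reflect_cube_symmetry reflect_reflect])
qed

section \<open>The value of the distance and the pairs achieving it\<close>

lemma hypercube_eq_cbox: "hypercube k = cbox 0 (\<chi> i. real k)"
  by (auto simp: hypercube_def mem_box_cart)

text \<open>Equality leaves only an extremal pair of edges. These are an image of the star pair, and
  by convexity they lie in \<open>P\<close> and \<open>Q\<close>.\<close>

lemma disjoint_lattice_polytopes_distance: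
  fixes P Q :: "(real^3) set"
  assumes k: "6 \<le> k" and PQ: "disjoint_lattice_polytopes k P Q"
  shows "1 \<le> (setdist P Q)\<^sup>2 * real_of_int (extremal_sq (int k))"
    and "(setdist P Q)\<^sup>2 * real_of_int (extremal_sq (int k)) = 1 \<Longrightarrow>
      \<exists>f \<in> cube_symmetries k. f ` P_star k \<subseteq> P \<and> f ` Q_star k \<subseteq> Q \<or> f ` P_star k \<subseteq> Q \<and> f ` Q_star k \<subseteq> P"
proof -
  let ?d = "(setdist P Q)\<^sup>2 * real_of_int (extremal_sq (int k))"
  obtain V W where V: "finite V" "V \<noteq> {}" "V \<subseteq> integer_lattice" "P = convex hull V" "P \<subseteq> hypercube k"
    and W: "finite W" "W \<noteq> {}" "W \<subseteq> integer_lattice" "Q = convex hull W" "Q \<subseteq> hypercube k"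
    and disjoint: "P \<inter> Q = {}"
    using PQ by (auto simp: disjoint_lattice_polytopes_def lattice_polytope_in_def lattice_polytope_def)
  have VP: "V \<subseteq> P" and WQ: "W \<subseteq> Q" using V W by (auto simp: hull_inc)
  then have cube: "V \<subseteq> hypercube k" "W \<subseteq> hypercube k" using V W by auto
  have "1 < ?d \<or> ?d = 1 \<and> (\<exists>f \<in> cube_symmetries k. f ` P_star k \<subseteq> P \<and> f ` Q_star k \<subseteq> Q \<or> f ` P_star k \<subseteq> Q \<and> f ` Q_star k \<subseteq> P)"
    using lattice_hulls_distance[OF k V(1-3) cube(1) W(1-3) cube(2), folded V(4) W(4), OF disjoint]
  proof (elim disjE bexE conjE)
    fix x1 x2 y1 y2
    assume mem: "x1 \<in> V" "x2 \<in> V" "y1 \<in> W" "y2 \<in> W"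
      and *: "\<bar>(x1 - y1) \<bullet> ((x2 - x1) \<times> (y2 - y1))\<bar> = 1"
        "real_of_int (extremal_sq (int k)) \<le> (norm ((x2 - x1) \<times> (y2 - y1)))\<^sup>2"
        "(setdist P Q)\<^sup>2 * (norm ((x2 - x1) \<times> (y2 - y1)))\<^sup>2 = 1"
    then have "star_like k x1 x2 y1 y2"
      using V(3) W(3) cube by (intro extremal_pair_imp_star_like[OF k]) (auto simp: extremal_pair_def)
    then obtain f where norm: "(norm ((x2 - x1) \<times> (y2 - y1)))\<^sup>2 = real_of_int (extremal_sq (int k))"
      and f: "f \<in> cube_symmetries k"
        "f ` P_star k = closed_segment x1 x2 \<and> f ` Q_star k = closed_segment y1 y2 \<or>
         f ` P_star k = closed_segment y1 y2 \<and> f ` Q_star k = closed_segment x1 x2"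
      unfolding star_like_def by blast
    have "convex P" "convex Q" by (simp_all add: V(4) W(4))
    then have "closed_segment x1 x2 \<subseteq> P" "closed_segment y1 y2 \<subseteq> Q"
      using mem VP WQ by (meson closed_segment_subset subsetD)+
    with f(2) have "f ` P_star k \<subseteq> P \<and> f ` Q_star k \<subseteq> Q \<or> f ` P_star k \<subseteq> Q \<and> f ` Q_star k \<subseteq> P"
      by (elim disjE conjE) simp_all
    then show ?thesis using *(3) f(1) norm by auto
  qed auto
  then show "1 \<le> ?d" "?d = 1 \<Longrightarrow> \<exists>f \<in> cube_symmetries k. f ` P_star k \<subseteq> P \<and> f ` Q_star k \<subseteq> Q \<or> f ` P_star k \<subseteq> Q \<and> f ` Q_star k \<subseteq> P"
    by auto
qed

lemma star_closest_points:
  assumes k: "6 \<le> k"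
  obtains p q where "p \<in> P_star k" "q \<in> Q_star k" "(dist p q)\<^sup>2 * real_of_int (extremal_sq (int k)) = 1"
proof -
  define r where "r = real k"
  define M where "M = 8 * r ^ 4 - 24 * r ^ 3 + 40 * r\<^sup>2 - 28 * r + 10"
  have M: "real_of_int (extremal_sq (int k)) = M" by (simp add: M_def r_def extremal_sq_def)
  then have "1 < M" using extremal_sq_bounds(4)[OF k] by simp
  \<comment> \<open>\<open>A / M\<close> and \<open>B / M\<close> solve the normal equations for the closest points of the two lines.\<close>
  define A where "A = 4 * r ^ 4 - 12 * r ^ 3 + 22 * r\<^sup>2 - 17 * r + 7"
  define B where "B = 4 * r ^ 4 - 8 * r ^ 3 + 10 * r\<^sup>2 - r"
  define j where "j = r - 6"
  have j: "r = 6 + j" and "0 \<le> j" using k by (auto simp: j_def r_def)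
  then have nonneg: "0 \<le> j" "0 \<le> j * j" "0 \<le> j * (j * j)" "0 \<le> j * (j * (j * j))" by auto
  have "0 \<le> A" unfolding A_def j
    by (simp add: algebra_simps power2_eq_square power3_eq_cube power4_eq_xxxx; insert nonneg; linarith)
  moreover have "0 \<le> B" unfolding B_def j
    by (simp add: algebra_simps power2_eq_square power3_eq_cube power4_eq_xxxx; insert nonneg; linarith)
  moreover have "A \<le> M" unfolding A_def M_def j
    by (simp add: algebra_simps power2_eq_square power3_eq_cube power4_eq_xxxx; insert nonneg; linarith)
  moreover have "B \<le> M" unfolding B_def M_def j
    by (simp add: algebra_simps power2_eq_square power3_eq_cube power4_eq_xxxx; insert nonneg; linarith)
  ultimately have AB: "0 \<le> A / M" "A / M \<le> 1" "0 \<le> B / M" "B / M \<le> 1" using \<open>1 < M\<close> by auto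
  define p :: "real^3" where "p = (1 - A / M) *\<^sub>R vector [r, 2, 1] + (A / M) *\<^sub>R vector [0, r - 1, r]"
  define q :: "real^3" where "q = (1 - B / M) *\<^sub>R 0 + (B / M) *\<^sub>R vector [r - 1, r, r]"
  \<comment> \<open>Minus the cross product of the directions of \<open>P_star k\<close> and
    \<open>Q_star k\<close>. Its squared length is \<open>M\<close>, and \<open>p - q\<close> will
    be \<open>n\<close> divided by \<open>M\<close>.\<close>
  define n :: "real^3" where "n = vector [2 * r, - (2 * r\<^sup>2 - 2 * r + 1), 2 * r\<^sup>2 - 4 * r + 3]"
  have "M *\<^sub>R (p - q) = (M - A) *\<^sub>R vector [r, 2, 1] + A *\<^sub>R vector [0, r - 1, r] - B *\<^sub>R vector [r - 1, r, r]"
    using \<open>1 < M\<close> unfolding p_def q_def by (simp add: scaleR_diff_right scaleR_add_right algebra_simps)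
  also have "\<dots> = n"
    by (simp add: vec_eq_iff forall_3 n_def A_def B_def M_def)
      (simp add: algebra_simps power2_eq_square power3_eq_cube power4_eq_xxxx)
  finally have "M\<^sup>2 * (dist p q)\<^sup>2 = (norm n)\<^sup>2"
    using \<open>1 < M\<close> by (metis abs_of_pos dist_norm less_trans norm_scaleR power_mult_distrib zero_less_one)
  also have "(norm n)\<^sup>2 = M"
    unfolding norm_sq_3
    by (simp add: n_def M_def algebra_simps power2_eq_square power3_eq_cube power4_eq_xxxx)
  finally have "(dist p q)\<^sup>2 * M = 1" using \<open>1 < M\<close> by (simp add: power2_eq_square field_simps)
  moreover have "p \<in> P_star k" "q \<in> Q_star k"
    using AB unfolding P_star_def Q_star_def closed_segment_def p_def q_def r_def by blast+
  ultimately show thesis using that M by simp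
qed

lemma lattice_polytope_in_segment:
  assumes "a \<in> integer_lattice" "b \<in> integer_lattice" "a \<in> hypercube k" "b \<in> hypercube k"
  shows "lattice_polytope_in k (closed_segment a b)"
  unfolding lattice_polytope_in_def lattice_polytope_def
proof (intro conjI exI)
  show "closed_segment a b = convex hull {a, b}" by (rule segment_convex_hull)
  show "closed_segment a b \<subseteq> hypercube k"
    using assms unfolding hypercube_eq_cbox by (intro closed_segment_subset convex_box)
qed (use assms in auto)

text \<open>The explicit points bound the distance from above and the general estimate bounds it
  from below, so their optimality needs no separate proof.\<close>

lemma star_image_achieves:
  assumes k: "6 \<le> k" and f: "f \<in> cube_symmetries k"
  shows "disjoint_lattice_polytopes k (f ` P_star k) (f ` Q_star k)"
    and "(setdist (f ` P_star k) (f ` Q_star k))\<^sup>2 * real_of_int (extremal_sq (int k)) = 1"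
proof -
  let ?a = "vector [real k, 2, 1] :: real^3" and ?b = "vector [0, real k - 1, real k] :: real^3"
    and ?d = "vector [real k - 1, real k, real k] :: real^3"
  have lattice: "x \<in> integer_lattice" "x \<in> hypercube k" if "x \<in> {?a, ?b, 0, ?d}" for x
    using that k by (auto simp: integer_lattice_def hypercube_def forall_3)
  have img: "f x \<in> integer_lattice" "f x \<in> hypercube k" if "x \<in> {?a, ?b, 0, ?d}" for x
    using lattice[OF that] k by (auto simp: cube_symmetry_lattice[OF f] cube_symmetryD(2)[OF f])
  have "P_star k \<inter> Q_star k = {}"
  proof -
    let ?n = "(?b - ?a) \<times> ?d"
    \<comment> \<open>The segments lie in two distinct parallel planes with normal
      \<open>?n\<close>.\<close>
    have "(p - q) \<bullet> ?n = -1" if p: "p \<in> P_star k" and q: "q \<in> Q_star k" for p q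
    proof -
      obtain u where u: "p = (1 - u) *\<^sub>R ?a + u *\<^sub>R ?b"
        using p unfolding P_star_def in_segment by blast
      obtain v where v: "q = (1 - v) *\<^sub>R 0 + v *\<^sub>R ?d"
        using q unfolding Q_star_def in_segment by blast
      show ?thesis unfolding u v by (simp add: cross3_def inner_vec_def sum_3 algebra_simps)
    qed
    then show ?thesis by fastforce
  qed
  then have "f ` P_star k \<inter> f ` Q_star k = {}"
    using cube_symmetryD(3)[OF f] by (metis image_Int image_empty)
  then show disj: "disjoint_lattice_polytopes k (f ` P_star k) (f ` Q_star k)"
    unfolding disjoint_lattice_polytopes_def P_star_def Q_star_def cube_symmetry_segment[OF f]
    by (auto intro!: lattice_polytope_in_segment img)
  obtain p q where pq: "p \<in> P_star k" "q \<in> Q_star k" "(dist p q)\<^sup>2 * real_of_int (extremal_sq (int k)) = 1"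
    by (rule star_closest_points[OF k])
  have "setdist (f ` P_star k) (f ` Q_star k) \<le> dist p q"
    using setdist_le_dist[of "f p" "f ` P_star k" "f q" "f ` Q_star k"] pq by (simp add: cube_symmetryD(1)[OF f])
  then have "(setdist (f ` P_star k) (f ` Q_star k))\<^sup>2 \<le> (dist p q)\<^sup>2" by (simp add: power_mono)
  then have "(setdist (f ` P_star k) (f ` Q_star k))\<^sup>2 * real_of_int (extremal_sq (int k)) \<le> 1"
    unfolding pq(3)[symmetric] using extremal_sq_bounds(4)[OF k] by (intro mult_right_mono) auto
  then show "(setdist (f ` P_star k) (f ` Q_star k))\<^sup>2 * real_of_int (extremal_sq (int k)) = 1"
    using disjoint_lattice_polytopes_distance(1)[OF k disj] by linarith
qed

text \<open>The star pair attains the infimum, which can therefore be replaced by an explicit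
  value.\<close>

lemma achieves_kissing_distance_iff:
  fixes P Q :: "(real^3) set"
  assumes k: "6 \<le> k"
  shows "achieves_kissing_distance k P Q \<longleftrightarrow>
    disjoint_lattice_polytopes k P Q \<and> (setdist P Q)\<^sup>2 * real_of_int (extremal_sq (int k)) = 1"
proof -
  let ?M = "real_of_int (extremal_sq (int k))"
  have M: "0 < ?M" using extremal_sq_bounds(4)[OF k] by linarith
  have star: "disjoint_lattice_polytopes k (P_star k) (Q_star k)" "(setdist (P_star k) (Q_star k))\<^sup>2 * ?M = 1"
    using star_image_achieves[OF k id_cube_symmetry] by simp_all
  have "kissing_distance TYPE(3) k = setdist (P_star k) (Q_star k)"
    unfolding kissing_distance_def
  proof (rule cInf_eq_minimum)
    fix x assume "x \<in> {setdist P Q |P Q :: (real^3) set. disjoint_lattice_polytopes k P Q}"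
    then obtain P Q :: "(real^3) set" where "x = setdist P Q" "disjoint_lattice_polytopes k P Q" by auto
    then have "(setdist (P_star k) (Q_star k))\<^sup>2 * ?M \<le> x\<^sup>2 * ?M" "0 \<le> x"
      using disjoint_lattice_polytopes_distance(1)[OF k] star by auto
    then show "setdist (P_star k) (Q_star k) \<le> x" using M by (auto intro: power2_le_imp_le)
  qed (use star in blast)
  moreover have "x\<^sup>2 * ?M = 1 \<longleftrightarrow> x = setdist (P_star k) (Q_star k)" if "0 \<le> x" for x
  proof -
    have "x\<^sup>2 * ?M = 1 \<longleftrightarrow> x\<^sup>2 = (setdist (P_star k) (Q_star k))\<^sup>2" using star(2) M by (metis mult_cancel_right less_irrefl)
    then show ?thesis using that by (simp add: power2_eq_iff_nonneg)
  qed
  ultimately show ?thesis unfolding achieves_kissing_distance_def by auto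
qed

section \<open>Inclusions between images of the two segments\<close>

lemma affine_parameter:
  fixes a b :: "'a::real_normed_vector"
  assumes "x \<in> closed_segment a b" "y \<in> closed_segment a b"
  obtains u v where "0 \<le> u" "u \<le> 1" "0 \<le> v" "v \<le> 1" "x = (1 - u) *\<^sub>R a + u *\<^sub>R b" "y = (1 - v) *\<^sub>R a + v *\<^sub>R b"
    "dist x y = \<bar>u - v\<bar> * dist a b"
proof -
  obtain u where u: "0 \<le> u" "u \<le> 1" "x = (1 - u) *\<^sub>R a + u *\<^sub>R b" using assms(1) unfolding in_segment by blast
  obtain v where v: "0 \<le> v" "v \<le> 1" "y = (1 - v) *\<^sub>R a + v *\<^sub>R b" using assms(2) unfolding in_segment by blast
  have "x - y = (u - v) *\<^sub>R (b - a)" by (simp add: u v algebra_simps)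
  then have "dist x y = \<bar>u - v\<bar> * dist a b" by (simp add: dist_norm norm_minus_commute)
  then show thesis using u v that by blast
qed

lemma dist_le_if_mem_segment:
  fixes a b :: "'a::real_normed_vector"
  assumes "x \<in> closed_segment a b" "y \<in> closed_segment a b"
  shows "dist x y \<le> dist a b"
proof -
  obtain u v where "0 \<le> u" "u \<le> 1" "0 \<le> v" "v \<le> 1" "dist x y = \<bar>u - v\<bar> * dist a b"
    by (rule affine_parameter[OF assms]) blast
  moreover from this have "\<bar>u - v\<bar> \<le> 1" by linarith
  ultimately show ?thesis using mult_right_mono[of "\<bar>u - v\<bar>" 1 "dist a b"] by simp
qed

lemma closed_segment_eq_if_dist_eq:
  fixes a b :: "'a::real_normed_vector"
  assumes "x \<in> closed_segment a b" "y \<in> closed_segment a b" "dist x y = dist a b"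
  shows "closed_segment x y = closed_segment a b"
proof (cases "a = b")
  case True
  then show ?thesis using assms by simp
next
  case False
  obtain u v where uv: "0 \<le> u" "u \<le> 1" "0 \<le> v" "v \<le> 1" "x = (1 - u) *\<^sub>R a + u *\<^sub>R b" "y = (1 - v) *\<^sub>R a + v *\<^sub>R b"
      "dist x y = \<bar>u - v\<bar> * dist a b"
    by (rule affine_parameter[OF assms(1,2)]) blast
  then have "\<bar>u - v\<bar> = 1" using assms(3) False by simp
  then have "u = 0 \<and> v = 1 \<or> u = 1 \<and> v = 0" using uv(1-4) by linarith
  then show ?thesis using uv(5,6) by (auto simp: closed_segment_commute)
qed

text \<open>Isometries preserve length, and a segment contains neither a longer segment nor another
  one of its own length.\<close>

lemma star_image_subset:
  assumes k: "6 \<le> k" and f: "f \<in> cube_symmetries k" and g: "g \<in> cube_symmetries k"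
  shows "g ` P_star k \<subseteq> f ` P_star k \<Longrightarrow> g ` P_star k = f ` P_star k"
    and "g ` Q_star k \<subseteq> f ` Q_star k \<Longrightarrow> g ` Q_star k = f ` Q_star k"
    and "\<not> g ` Q_star k \<subseteq> f ` P_star k"
proof -
  have eq: "g ` closed_segment a b = f ` closed_segment a b"
    if sub: "g ` closed_segment a b \<subseteq> f ` closed_segment a b" for a b
  proof -
    have "g a \<in> closed_segment (f a) (f b)" "g b \<in> closed_segment (f a) (f b)"
      using sub by (auto simp flip: cube_symmetry_segment[OF f])
    moreover have "dist (g a) (g b) = dist (f a) (f b)"
      by (simp add: cube_symmetryD(1)[OF f] cube_symmetryD(1)[OF g])
    ultimately show ?thesis
      unfolding cube_symmetry_segment[OF f] cube_symmetry_segment[OF g] by (rule closed_segment_eq_if_dist_eq)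
  qed
  show "g ` P_star k \<subseteq> f ` P_star k \<Longrightarrow> g ` P_star k = f ` P_star k"
    "g ` Q_star k \<subseteq> f ` Q_star k \<Longrightarrow> g ` Q_star k = f ` Q_star k"
    unfolding P_star_def Q_star_def by (rule eq, assumption)+
  show "\<not> g ` Q_star k \<subseteq> f ` P_star k"
  proof
    let ?a = "vector [real k, 2, 1] :: real^3" and ?b = "vector [0, real k - 1, real k] :: real^3"
      and ?d = "vector [real k - 1, real k, real k] :: real^3"
    assume sub: "g ` Q_star k \<subseteq> f ` P_star k"
    have "g 0 \<in> f ` P_star k" "g ?d \<in> f ` P_star k"
      using sub by (auto simp: Q_star_def)
    then have "dist (g 0) (g ?d) \<le> dist (f ?a) (f ?b)"
      unfolding P_star_def cube_symmetry_segment[OF f] by (rule dist_le_if_mem_segment)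
    then have "dist 0 ?d \<le> dist ?a ?b"
      by (simp only: cube_symmetryD(1)[OF f] cube_symmetryD(1)[OF g])
    then have "(norm (0 - ?d))\<^sup>2 \<le> (norm (?a - ?b))\<^sup>2" unfolding dist_norm by (simp add: power_mono)
    \<comment> \<open>The squared lengths are \<open>3 * k ^ 2 - 2 * k + 1\<close> for
      \<open>Q_star k\<close> and \<open>3 * k ^ 2 - 8 * k + 10\<close> for
      \<open>P_star k\<close>.\<close>
    then show False using k unfolding norm_sq_3 by (simp add: algebra_simps power2_eq_square)
  qed
qed

theorem mainTheorem3:
  fixes k :: nat
  assumes "k \<ge> 6"
  shows "achieves_kissing_distance k (P_star k) (Q_star k)
    \<and> (\<forall>P Q :: (real^3) set. achieves_kissing_distance k P Q \<longrightarrow>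
          (\<exists>f \<in> cube_symmetries k.
             f ` P_star k \<subseteq> P \<and> f ` Q_star k \<subseteq> Q \<or>
             f ` P_star k \<subseteq> Q \<and> f ` Q_star k \<subseteq> P))
    \<and> (\<forall>P Q :: (real^3) set. minimally_achieves_kissing_distance k P Q \<longleftrightarrow>
          (\<exists>f \<in> cube_symmetries k.
             P = f ` P_star k \<and> Q = f ` Q_star k \<or>
             P = f ` Q_star k \<and> Q = f ` P_star k))"
proof -
  note achieves_iff = achieves_kissing_distance_iff[OF assms]
  have comm: "achieves_kissing_distance k P Q \<longleftrightarrow> achieves_kissing_distance k Q P" for P Q :: "(real^3) set"
    unfolding achieves_iff disjoint_lattice_polytopes_def by (auto simp: setdist_sym Int_commute)
  have image: "achieves_kissing_distance k (f ` P_star k) (f ` Q_star k)" if "f \<in> cube_symmetries k" for f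
    using star_image_achieves[OF assms that] achieves_iff by blast
  have unique: "\<exists>f \<in> cube_symmetries k. f ` P_star k \<subseteq> P \<and> f ` Q_star k \<subseteq> Q \<or> f ` P_star k \<subseteq> Q \<and> f ` Q_star k \<subseteq> P"
    if "achieves_kissing_distance k P Q" for P Q
    using disjoint_lattice_polytopes_distance(2)[OF assms] that achieves_iff by blast
  \<comment> \<open>An achieving pair inside an image of the star pair contains a second image.
    Their lengths exclude the crossed inclusion and turn the other one into equality.\<close>
  have image_minimal: "P = f ` P_star k \<and> Q = f ` Q_star k"
    if achieves: "achieves_kissing_distance k P Q" and sub: "P \<subseteq> f ` P_star k" "Q \<subseteq> f ` Q_star k" and f: "f \<in> cube_symmetries k" for f P Q
  proof -
    obtain g where g: "g \<in> cube_symmetries k"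
      "g ` P_star k \<subseteq> P \<and> g ` Q_star k \<subseteq> Q \<or> g ` P_star k \<subseteq> Q \<and> g ` Q_star k \<subseteq> P"
      using unique[OF achieves] by blast
    note images = star_image_subset[OF assms f g(1)]
    from g(2) show ?thesis
    proof
      assume "g ` P_star k \<subseteq> P \<and> g ` Q_star k \<subseteq> Q"
      moreover from this have "g ` P_star k = f ` P_star k" "g ` Q_star k = f ` Q_star k"
        using sub by (auto intro!: images(1,2) del: subsetI intro: subset_trans)
      ultimately show ?thesis using sub by (simp add: subset_antisym)
    next
      assume "g ` P_star k \<subseteq> Q \<and> g ` Q_star k \<subseteq> P"
      then have "g ` Q_star k \<subseteq> f ` P_star k" using sub(1) by (meson subset_trans)
      then show ?thesis using images(3) by contradiction
    qed
  qed
  have minimal_iff: "minimally_achieves_kissing_distance k P Q \<longleftrightarrow>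
      (\<exists>f \<in> cube_symmetries k. P = f ` P_star k \<and> Q = f ` Q_star k \<or> P = f ` Q_star k \<and> Q = f ` P_star k)" for P Q
  proof
    assume min: "minimally_achieves_kissing_distance k P Q"
    then have "achieves_kissing_distance k P Q" by (simp add: minimally_achieves_kissing_distance_def)
    have sub: "P' = P \<and> Q' = Q" if "P' \<subseteq> P" "Q' \<subseteq> Q" "achieves_kissing_distance k P' Q'" for P' Q'
      using that min unfolding minimally_achieves_kissing_distance_def by blast
    from \<open>achieves_kissing_distance k P Q\<close> obtain f where f: "f \<in> cube_symmetries k"
      "f ` P_star k \<subseteq> P \<and> f ` Q_star k \<subseteq> Q \<or> f ` P_star k \<subseteq> Q \<and> f ` Q_star k \<subseteq> P"
      using unique by blast
    \<comment> \<open>The contained image achieves the distance itself, so minimality makes the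
      inclusions equalities.\<close>
    then have "f ` P_star k = P \<and> f ` Q_star k = Q \<or> f ` Q_star k = P \<and> f ` P_star k = Q"
      using sub[of "f ` P_star k" "f ` Q_star k"] sub[of "f ` Q_star k" "f ` P_star k"] image[OF f(1)]
        comm[of "f ` P_star k" "f ` Q_star k"] by (elim disjE conjE) simp_all
    then show "\<exists>f \<in> cube_symmetries k. P = f ` P_star k \<and> Q = f ` Q_star k \<or> P = f ` Q_star k \<and> Q = f ` P_star k"
      using f(1) by blast
  next
    assume "\<exists>f \<in> cube_symmetries k. P = f ` P_star k \<and> Q = f ` Q_star k \<or> P = f ` Q_star k \<and> Q = f ` P_star k"
    then obtain f where f: "f \<in> cube_symmetries k"
      and PQ: "P = f ` P_star k \<and> Q = f ` Q_star k \<or> P = f ` Q_star k \<and> Q = f ` P_star k" by blast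
    have "achieves_kissing_distance k P Q" using PQ image[OF f] comm by auto
    moreover have "P' = P \<and> Q' = Q" if "P' \<subseteq> P" "Q' \<subseteq> Q" "achieves_kissing_distance k P' Q'" for P' Q'
      using PQ that image_minimal[of P' Q' f] image_minimal[of Q' P' f] f comm[of P' Q'] by (elim disjE conjE) simp_all
    ultimately show "minimally_achieves_kissing_distance k P Q"
      unfolding minimally_achieves_kissing_distance_def by blast
  qed
  show ?thesis using image[OF id_cube_symmetry] unique minimal_iff by simp
qed

end
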